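(* Given a closed-loop buck converter with a control-to-output transfer function $G_{vd}(s)$ and a compensator transfer function $G_c(s)$, let the harmonic balance (HB) gain be $G(s)=G_c(s)G_{vd}(s)/v_s$. Saddle-node bifurcation (SNB) occurs when $$v_s \sum_{n=-\infty}^{\infty} e^{j2n\pi D}\, G(jn\omega_s) + V_h = 0 .$$
   Context: The converter is under voltage mode control. Here $j=\sqrt{-1}$, $T$ is the switching period, $\omega_s=2\pi/T$, $v_s$ is the source voltage, $v_r$ the reference signal, $h(t)$ the $T$-periodic ramp signal with amplitude $V_h$ (slope $V_h/T$), $D$ the steady-state duty cycle and $d=DT$ the steady-state switching instant. Power stage. With inductance $L$, capacitance $C$, load resistance $R$ and equivalent series resistance $R_c$, $$G_v(s)=\frac{G_{vd}(s)}{v_s}=\frac{sR_cC+1}{LC(1+\frac{R_c}{R})s^2+(\frac LR+R_cC)s+1}$$ is the transfer function from $v_d$, the voltage across the OFF switch (or diode), to the output voltage $v_o$. $G_c(s)$ is the compensator transfer function from $v_o$ to $-y$, where $y$ is the compensator output, so $G(s)=G_c(s)G_v(s)$ is the transfer function from $v_d$ to $-y$. In steady state, $v_d(t)$ is a square wave with high voltage $v_s$ and low voltage $0$, $v_d(t)=\sum_{n=-\infty}^{\infty}c_ne^{jn\omega_st}$ with $c_n=\frac{v_s}{j2n\pi}(1-e^{-jn\omega_sd})$ (and $c_0=v_sD$). Then $y(t)=(1+G_c(0))v_r-\sum_{n=-\infty}^{\infty}c_ne^{jn\omega_st}G(jn\omega_s)$. The intersection of $y(t)$ and $h(t)$ determines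 the duty cycle, so in steady state $$y(d)-h(d)=(1+G_c(0))v_r-\sum_{n=-\infty}^{\infty}c_ne^{jn\omega_sd}G(jn\omega_s)-h(d)=0,$$ an equation in $d=DT$. SNB refers to a saddle-node bifurcation of the $T$-periodic steady-state solution: it occurs when one eigenvalue of the Jacobian matrix of the linearized sampled-data (period-to-period) dynamics is $1$. When SNB occurs only a single solution $d$ of the steady-state equation exists, which means that the curve $y(d)-h(d)$ has a flat slope at the critical value of $d$. *)

theory Defs
  imports "HOL-Analysis.Analysis"
begin

text \<open>
  A buck converter under voltage mode control.  The compensator is an arbitrary proper
  finite-dimensional linear system, given by a real state-space realization with states
  indexed by \<open>'n\<close> and input \<open>v\<^sub>o - v\<^sub>r\<close>.  (A static compensator is covered by taking
  \<open>comp_C = 0\<close> and any \<open>comp_A\<close> without eigenvalues on the imaginary axis.)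
\<close>

record ('n::finite) buck =
  inductance  :: real
  capacitance :: real
  load_res    :: real
  esr         :: real
  v_source    :: real
  v_ref       :: real
  period      :: real
  ramp_amp    :: real
  comp_A      :: "real ^ 'n ^ 'n"
  comp_B      :: "real ^ 'n"
  comp_C      :: "real ^ 'n"
  comp_D      :: real

definition well_formed :: "('n::finite) buck \<Rightarrow> bool" where
  "well_formed p \<longleftrightarrow>
     inductance p > 0 \<and> capacitance p > 0 \<and> load_res p > 0 \<and> esr p \<ge> 0 \<and>
     v_source p > 0 \<and> period p > 0"

definition switching_freq :: "('n::finite) buck \<Rightarrow> real" where
  "switching_freq p = 2 * pi / period p"

definition G_vd :: "('n::finite) buck \<Rightarrow> complex \<Rightarrow> complex" where
  "G_vd p s =
     of_real (v_source p) *
     (s * of_real (esr p * capacitance p) + 1) /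
     (of_real (inductance p * capacitance p * (1 + esr p / load_res p)) * s\<^sup>2
      + of_real (inductance p / load_res p + esr p * capacitance p) * s + 1)"

definition comp_char_matrix :: "('n::finite) buck \<Rightarrow> complex \<Rightarrow> complex ^ 'n ^ 'n" where
  "comp_char_matrix p s = mat s - (\<chi> i k. of_real (comp_A p $ i $ k))"

text \<open>Transfer function \<open>c\<^sup>T (s I - A)\<inverse> b + d\<close> of the compensator, from \<open>v\<^sub>o\<close> to \<open>-y\<close>.\<close>

definition G_c :: "('n::finite) buck \<Rightarrow> complex \<Rightarrow> complex" where
  "G_c p s =
     (\<Sum>i\<in>UNIV. of_real (comp_C p $ i) *
        (matrix_inv (comp_char_matrix p s) *v (\<chi> k. of_real (comp_B p $ k))) $ i)
     + of_real (comp_D p)"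

definition HB_gain :: "('n::finite) buck \<Rightarrow> complex \<Rightarrow> complex" where
  "HB_gain p s = G_c p s * G_vd p s / of_real (v_source p)"

text \<open>
  The values \<open>G (j n \<omega>\<^sub>s)\<close> are meaningful only if the compensator has no pole at a harmonic
  of the switching frequency (in particular, none at the origin).  The power stage itself has
  no poles on the imaginary axis.
\<close>

definition no_harmonic_poles :: "('n::finite) buck \<Rightarrow> bool" where
  "no_harmonic_poles p \<longleftrightarrow>
     (\<forall>n::int. det (comp_char_matrix p (\<i> * of_int n * of_real (switching_freq p))) \<noteq> 0)"

text \<open>State: inductor current, capacitor voltage, compensator state.\<close>

type_synonym 'n state = "real \<times> real \<times> (real ^ 'n)"

text \<open>
  The load voltage solves \<open>v\<^sub>o = v\<^sub>C + R\<^sub>c i\<^sub>C\<close> with capacitor current \<open>i\<^sub>C = i\<^sub>L - v\<^sub>o / R\<close>.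
\<close>

fun out_voltage :: "('n::finite) buck \<Rightarrow> 'n state \<Rightarrow> real" where
  "out_voltage p (iL, vC, z) =
     load_res p / (load_res p + esr p) * (vC + esr p * iL)"

text \<open>Vector field for a given value \<open>vd\<close> of the voltage across the OFF switch.\<close>

fun field :: "('n::finite) buck \<Rightarrow> real \<Rightarrow> 'n state \<Rightarrow> 'n state" where
  "field p vd (iL, vC, z) =
     (let vo = out_voltage p (iL, vC, z) in
       ((vd - vo) / inductance p,
        (iL - vo / load_res p) / capacitance p,
        comp_A p *v z + (vo - v_ref p) *\<^sub>R comp_B p))"

text \<open>
  For constant \<open>v\<^sub>r\<close> this output is \<open>y = v\<^sub>r - G\<^sub>c (v\<^sub>o - v\<^sub>r)\<close>, whose steady state
  is \<open>(1 + G\<^sub>c 0) v\<^sub>r - G\<^sub>c v\<^sub>o\<close>.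
\<close>

fun comp_out :: "('n::finite) buck \<Rightarrow> 'n state \<Rightarrow> real" where
  "comp_out p (iL, vC, z) =
     v_ref p - (comp_C p \<bullet> z + comp_D p * (out_voltage p (iL, vC, z) - v_ref p))"

definition trajectory :: "('n::finite) buck \<Rightarrow> real \<Rightarrow> 'n state \<Rightarrow> (real \<Rightarrow> 'n state) \<Rightarrow> bool" where
  "trajectory p vd x0 x \<longleftrightarrow>
     x 0 = x0 \<and> (\<forall>t. (x has_vector_derivative field p vd (x t)) (at t))"

definition flow :: "('n::finite) buck \<Rightarrow> real \<Rightarrow> 'n state \<Rightarrow> real \<Rightarrow> 'n state" where
  "flow p vd x0 = (THE x. trajectory p vd x0 x)"

definition ramp :: "('n::finite) buck \<Rightarrow> real \<Rightarrow> real" where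
  "ramp p t = ramp_amp p * frac (t / period p)"

text \<open>
  Trailing-edge modulation: a cycle starts with \<open>v\<^sub>d = v\<^sub>s\<close>, and the switch is turned off
  for the rest of the cycle as soon as the ramp meets \<open>y\<close>; if this does not happen within
  the cycle, the switch stays on throughout.
\<close>

definition switching_instant :: "('n::finite) buck \<Rightarrow> 'n state \<Rightarrow> real" where
  "switching_instant p x0 =
     Inf (insert (period p)
       {t. 0 \<le> t \<and> t < period p \<and> comp_out p (flow p (v_source p) x0 t) \<le> ramp p t})"

definition sampled_map :: "('n::finite) buck \<Rightarrow> 'n state \<Rightarrow> 'n state" where
  "sampled_map p x0 =
     (let d = switching_instant p x0
      in flow p 0 (flow p (v_source p) x0 d) (period p - d))"

text \<open>
  A \<open>T\<close>-periodic steady state, represented by its state \<open>x0\<close> at the start of a cycle, with a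
  genuine switching instant \<open>d\<close> strictly inside the cycle.
\<close>

definition steady_state :: "('n::finite) buck \<Rightarrow> 'n state \<Rightarrow> real \<Rightarrow> bool" where
  "steady_state p x0 d \<longleftrightarrow>
     sampled_map p x0 = x0 \<and> switching_instant p x0 = d \<and> 0 < d \<and> d < period p"

definition is_eigenvalue :: "('a::real_vector \<Rightarrow> 'a) \<Rightarrow> real \<Rightarrow> bool" where
  "is_eigenvalue f c \<longleftrightarrow> (\<exists>v. v \<noteq> 0 \<and> f v = c *\<^sub>R v)"

definition saddle_node :: "('n::finite) buck \<Rightarrow> 'n state \<Rightarrow> bool" where
  "saddle_node p x0 \<longleftrightarrow>
     sampled_map p differentiable (at x0) \<and>
     is_eigenvalue (frechet_derivative (sampled_map p) (at x0)) 1"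

text \<open>
  Bilateral series are sums of Fourier type, i.e. limits of symmetric partial sums; they
  need not converge absolutely, since \<open>G (j n \<omega>\<^sub>s)\<close> may decay only like \<open>1 / n\<close>.
\<close>

definition bilateral_sums :: "(int \<Rightarrow> complex) \<Rightarrow> complex \<Rightarrow> bool" where
  "bilateral_sums f S \<longleftrightarrow> (\<lambda>N::nat. \<Sum>n\<in>{- int N..int N}. f n) \<longlonglongrightarrow> S"

end

theory Submission
  imports Defs
begin

text \<open>
  Write \<open>\<Phi>\<^sub>t\<close> for the flow of the linear part \<open>f\<close> of the vector field, \<open>K\<close> for the linear map with
  \<open>y = const - K x\<close>, and \<open>b = (1 / L, 0, 0)\<close>.  No eigenvalue of \<open>f\<close> lies at a harmonic of the
  switching frequency, so \<open>id - \<Phi>\<^sub>T\<close> is invertible; let \<open>w = (id - \<Phi>\<^sub>T)\<inverse> b\<close>.  The curve \<open>K (\<Phi>\<^sub>t w)\<close>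
  has Fourier integrals \<open>G (\<i> n \<omega>\<^sub>s)\<close> over a period, so the harmonic series sums to \<open>T K (\<Phi>\<^sub>d w)\<close>.
  If \<open>\<sigma>\<close> is the slope of \<open>y\<close> minus the ramp at the switching instant, the derivative of the sampled
  map is \<open>v \<mapsto> \<Phi>\<^sub>T v + l v\<^sub>s \<Phi>\<^sub>T\<^sub>-\<^sub>d b\<close> with \<open>\<sigma> l = K (\<Phi>\<^sub>d v)\<close>; it has eigenvalue \<open>1\<close> iff
  \<open>\<sigma> = v\<^sub>s K (\<Phi>\<^sub>T w)\<close>.  Periodicity of the steady state gives
  \<open>\<sigma> = v\<^sub>s K (\<Phi>\<^sub>T w) - v\<^sub>s K (\<Phi>\<^sub>d w) - V\<^sub>h / T\<close>.
\<close>

subsection \<open>Fourier series\<close>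

lemma has_vector_derivative_imp_quotient_tendsto:
  assumes "(f has_vector_derivative f') (at x)"
  shows "((\<lambda>t. (f t - f x) /\<^sub>R (t - x)) \<longlongrightarrow> f') (at x)"
proof -
  have "((\<lambda>t. norm (f t - f x - (t - x) *\<^sub>R f') / norm (t - x)) \<longlongrightarrow> 0) (at x)"
    using assms by (simp add: has_vector_derivative_def has_derivative_iff_norm)
  moreover have "\<forall>\<^sub>F t in at x. norm (f t - f x - (t - x) *\<^sub>R f') / norm (t - x) =
      norm ((f t - f x) /\<^sub>R (t - x) - f')"
    unfolding eventually_at_filter
  proof (rule always_eventually, intro allI impI)
    fix t assume t: "t \<noteq> x"
    have "(f t - f x) /\<^sub>R (t - x) - f' = (f t - f x - (t - x) *\<^sub>R f') /\<^sub>R (t - x)"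
      using t by (simp add: scaleR_diff_right)
    then show "norm (f t - f x - (t - x) *\<^sub>R f') / norm (t - x) = norm ((f t - f x) /\<^sub>R (t - x) - f')"
      by (simp add: divide_inverse mult.commute)
  qed
  ultimately have "((\<lambda>t. norm ((f t - f x) /\<^sub>R (t - x) - f')) \<longlongrightarrow> 0) (at x)"
    by (simp add: tendsto_cong)
  then show ?thesis using LIM_zero_iff tendsto_norm_zero_iff by blast
qed

text \<open>Uniform approximation by a polynomial reduces the claim to a differentiable integrand,
  for which one integration by parts gains a factor 1 / |w|.\<close>

lemma Riemann_Lebesgue_continuous:
  fixes r :: "real \<Rightarrow> complex"
  assumes ab: "a \<le> b" and cont: "continuous_on {a..b} r"
  shows "((\<lambda>w. integral {a..b} (\<lambda>t. cis (w * t) * r t)) \<longlongrightarrow> 0) at_infinity"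
proof (rule tendstoI)
  fix e :: real assume e: "e > 0"
  \<comment> \<open>Chosen so that an error below \<open>e'\<close>, integrated over the interval,
    costs at most e / 2; the summand 1 keeps the denominator positive when a = b.\<close>
  define e' where "e' = e / (2 * (b - a + 1))"
  have e': "e' > 0" using e ab by (simp add: e'_def)
  obtain g where g: "polynomial_function g" and rg: "\<And>x. x \<in> {a..b} \<Longrightarrow> norm (r x - g x) < e'"
    using Stone_Weierstrass_polynomial_function[OF compact_Icc cont e'] by blast
  obtain g' where g': "polynomial_function g'" "\<And>x. (g has_vector_derivative g' x) (at x)"
    using has_vector_derivative_polynomial_function[OF g] by blast
  have cg: "continuous_on {a..b} g" and cg': "continuous_on {a..b} g'"
    using g g' by (auto intro: continuous_on_polymonial_function)
  define N where "N = integral {a..b} (\<lambda>t. norm (g' t))"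
  define C where "C = norm (g a) + norm (g b) + N"
  have N: "norm (integral {a..b} (\<lambda>t. cis (w * t) * g' t)) \<le> N" for w
    unfolding N_def
    by (rule integral_norm_bound_integral)
      (auto intro!: integrable_continuous_real continuous_intros cg' simp: norm_mult)
  \<comment> \<open>The derivative of cis (w t) g t splits into the wanted integrand times i w and a
    remainder with g'; the boundary terms and the remainder are bounded independently of w.\<close>
  have parts: "\<bar>w\<bar> * norm (integral {a..b} (\<lambda>t. cis (w * t) * g t)) \<le> C" for w
  proof -
    have "((\<lambda>t. of_real w * \<i> * (cis (w * t) * g t) + cis (w * t) * g' t) has_integral
            (cis (w * b) * g b - cis (w * a) * g a)) {a..b}"
      by (rule fundamental_theorem_of_calculus[OF ab])
        (auto intro!: derivative_eq_intros g'(2)[unfolded has_vector_derivative_def, THEN has_derivative_at_withinI]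
          simp: has_vector_derivative_def scaleR_conv_of_real algebra_simps fun_eq_iff)
    moreover have "((\<lambda>t. of_real w * \<i> * (cis (w * t) * g t) + cis (w * t) * g' t) has_integral
          (of_real w * \<i> * integral {a..b} (\<lambda>t. cis (w * t) * g t) + integral {a..b} (\<lambda>t. cis (w * t) * g' t))) {a..b}"
      by (intro has_integral_add has_integral_mult_right integrable_integral
            integrable_continuous_real continuous_intros cg cg')
    ultimately have "of_real w * \<i> * integral {a..b} (\<lambda>t. cis (w * t) * g t) +
        integral {a..b} (\<lambda>t. cis (w * t) * g' t) = cis (w * b) * g b - cis (w * a) * g a"
      by (rule has_integral_unique[rotated])
    then have "of_real w * \<i> * integral {a..b} (\<lambda>t. cis (w * t) * g t) =
        (cis (w * b) * g b - cis (w * a) * g a) - integral {a..b} (\<lambda>t. cis (w * t) * g' t)"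
      by (simp add: eq_diff_eq)
    then have "norm (of_real w * \<i> * integral {a..b} (\<lambda>t. cis (w * t) * g t)) \<le>
        norm (cis (w * b) * g b) + norm (cis (w * a) * g a) + norm (integral {a..b} (\<lambda>t. cis (w * t) * g' t))"
      by (simp only:) (intro order_trans[OF norm_triangle_ineq4] add_mono norm_triangle_ineq4 order_refl)
    then show ?thesis using N[of w] by (simp add: norm_mult C_def)
  qed
  have diff: "norm (integral {a..b} (\<lambda>t. cis (w * t) * r t) - integral {a..b} (\<lambda>t. cis (w * t) * g t)) \<le> e / 2" for w
  proof -
    have "norm (integral {a..b} (\<lambda>t. cis (w * t) * r t) - integral {a..b} (\<lambda>t. cis (w * t) * g t))
       = norm (integral {a..b} (\<lambda>t. cis (w * t) * (r t - g t)))"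
      by (subst integral_diff[symmetric])
        (auto intro!: integrable_continuous_real continuous_intros cg cont simp: algebra_simps)
    also have "\<dots> \<le> integral {a..b} (\<lambda>t. e')"
      by (rule integral_norm_bound_integral)
        (auto intro!: integrable_continuous_real continuous_intros cg cont less_imp_le rg simp: norm_mult)
    also have "\<dots> \<le> e / 2"
      using ab e by (simp add: e'_def field_simps)
    finally show ?thesis .
  qed
  show "\<forall>\<^sub>F w in at_infinity. dist (integral {a..b} (\<lambda>t. cis (w * t) * r t)) 0 < e"
    unfolding eventually_at_infinity
  proof (intro exI allI impI)
    \<comment> \<open>Using C + 1 instead of C makes the threshold positive, so that w is nonzero,
      and makes the last estimate strict.\<close>
    fix w :: real assume w: "2 * (C + 1) / e \<le> norm w"
    have "0 \<le> C" using parts[of 0] by simp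
    then have w0: "0 < \<bar>w\<bar>" using w e by (smt (verit) divide_pos_pos real_norm_def)
    have "norm (integral {a..b} (\<lambda>t. cis (w * t) * g t)) \<le> C / \<bar>w\<bar>"
      using parts[of w] w0 by (simp add: field_simps)
    also have "\<dots> < e / 2"
      using w w0 e by (simp add: field_simps)
    finally show "dist (integral {a..b} (\<lambda>t. cis (w * t) * r t)) 0 < e"
      using diff[of w] norm_triangle_ineq2[of "integral {a..b} (\<lambda>t. cis (w * t) * r t)" "integral {a..b} (\<lambda>t. cis (w * t) * g t)"]
      by simp
  qed
qed

lemma integral_cis_full_period:
  fixes n :: int
  assumes T: "T > 0"
  shows "integral {0..T} (\<lambda>t. cis (of_int n * (2 * pi / T) * (t - d))) = (if n = 0 then of_real T else 0)"
proof (cases "n = 0")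
  case False
  define w where "w = of_int n * (2 * pi / T)"
  have w: "w \<noteq> 0" using False T by (simp add: w_def)
  have "((\<lambda>t. cis (w * (t - d))) has_integral
      cis (w * (T - d)) / (of_real w * \<i>) - cis (w * (0 - d)) / (of_real w * \<i>)) {0..T}"
    by (rule fundamental_theorem_of_calculus)
      (use T w in \<open>auto simp: has_vector_derivative_def scaleR_conv_of_real field_simps
          intro!: derivative_eq_intros\<close>)
  moreover have "cis (w * (T - d)) = cis (w * (0 - d))"
  proof -
    have *: "w * (T - d) = 2 * pi * of_int n + w * (0 - d)" using T by (simp add: w_def field_simps)
    have "cis (2 * pi * of_int n) = 1" by (rule cis_multiple_2pi) simp
    then show ?thesis unfolding * cis_mult[symmetric] by simp
  qed
  ultimately show ?thesis using False by (simp add: w_def integral_unique)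
qed (use T in \<open>simp add: scaleR_conv_of_real\<close>)

text \<open>
  Chernoff's argument: dividing \<open>u t - u d\<close> by \<open>cis (2 * pi / T * (t - d)) - 1\<close> makes the symmetric
  partial sums telescope, and the Riemann-Lebesgue lemma kills the two remaining terms.
\<close>

lemma Fourier_series_pointwise:
  fixes u :: "real \<Rightarrow> complex"
  assumes d: "0 < d" "d < T" and cont: "continuous_on {0..T} u"
    and diff: "(u has_vector_derivative u') (at d)"
  shows "bilateral_sums (\<lambda>n. cis (of_int n * (2 * pi / T) * d) *
           integral {0..T} (\<lambda>t. cis (- (of_int n * (2 * pi / T) * t)) * u t)) (of_real T * u d)"
proof -
  define om where "om = 2 * pi / T"
  have T: "T > 0" using d by simp
  have om: "om > 0" using T by (simp add: om_def)
  define q where "q t = cis (om * (t - d)) - 1" for t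
  \<comment> \<open>The value at d is the limit of the quotient: there the numerator has derivative
    u' and \<open>q\<close> has derivative i times \<open>om\<close>.\<close>
  define r where "r t = (if t = d then u' / (of_real om * \<i>) else (u t - u d) / q t)" for t
  \<comment> \<open>Zeros of \<open>q\<close> are spaced T apart, and d lies in the interior, so |t
    - d| < T excludes all of them but d itself.\<close>
  have q0: "q t \<noteq> 0" if "t \<in> {0..T}" "t \<noteq> d" for t
  proof
    assume "q t = 0"
    then have "cos (om * (t - d)) = 1" by (simp add: q_def complex_eq_iff)
    then obtain k :: int where k: "om * (t - d) = of_int k * 2 * pi" using cos_one_2pi_int by metis
    then have "(2 * pi) * (t - d) = (2 * pi) * (of_int k * T)" using T by (simp add: om_def field_simps)
    then have "t - d = of_int k * T" by (metis mult_cancel_left pi_neq_zero mult_eq_0_iff zero_neq_numeral)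
    moreover have "\<bar>t - d\<bar> < T" using that d by auto
    ultimately have "\<bar>of_int k\<bar> * T < 1 * T" using T by (simp add: abs_mult)
    then have "\<bar>of_int k :: real\<bar> < 1" using T mult_less_cancel_right_pos by blast
    then have "k = 0" by linarith
    with \<open>t - d = of_int k * T\<close> that show False by simp
  qed
  have ccq: "continuous_on A q" for A unfolding q_def by (intro continuous_intros)
  have contr: "continuous_on {0..T} r"
    unfolding continuous_on_def
  proof
    fix x assume x: "x \<in> {0..T}"
    show "(r \<longlongrightarrow> r x) (at x within {0..T})"
    proof (cases "x = d")
      case True
      have 1: "((\<lambda>t. (u t - u d) /\<^sub>R (t - d)) \<longlongrightarrow> u') (at d)"
        by (rule has_vector_derivative_imp_quotient_tendsto[OF diff])
      have "(q has_vector_derivative of_real om * \<i>) (at d)"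
        unfolding q_def by (auto simp: has_vector_derivative_def scaleR_conv_of_real
          intro!: derivative_eq_intros)
      then have 2: "((\<lambda>t. (q t - q d) /\<^sub>R (t - d)) \<longlongrightarrow> of_real om * \<i>) (at d)"
        by (rule has_vector_derivative_imp_quotient_tendsto)
      have "((\<lambda>t. ((u t - u d) /\<^sub>R (t - d)) / ((q t - q d) /\<^sub>R (t - d))) \<longlongrightarrow> u' / (of_real om * \<i>)) (at d)"
        using om by (intro tendsto_divide 1 2) auto
      moreover have "\<forall>\<^sub>F t in at d. ((u t - u d) /\<^sub>R (t - d)) / ((q t - q d) /\<^sub>R (t - d)) = r t"
        by (rule eventually_at_filter[THEN iffD2], rule always_eventually)
          (auto simp: r_def q_def scaleR_conv_of_real simp del: of_real_diff of_real_inverse)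
      ultimately have "(r \<longlongrightarrow> u' / (of_real om * \<i>)) (at d)"
        by (rule Lim_transform_eventually)
      then have "(r \<longlongrightarrow> r d) (at d)"
        by (simp add: r_def)
      then show ?thesis using True tendsto_within_subset by blast
    next
      case False
      have "((\<lambda>t. (u t - u d) / q t) \<longlongrightarrow> (u x - u d) / q x) (at x within {0..T})"
        using cont ccq[of "{0..T}"] q0[OF x False] x
        by (intro tendsto_intros) (auto simp: continuous_on_def)
      moreover have "\<forall>\<^sub>F t in at x within {0..T}. (u t - u d) / q t = r t"
        using False by (intro eventually_mono[OF eventually_neq_at_within[of d]]) (auto simp: r_def)
      ultimately have "(r \<longlongrightarrow> (u x - u d) / q x) (at x within {0..T})"
        by (rule Lim_transform_eventually)
      then show ?thesis using False by (simp add: r_def)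
    qed
  qed
  define R where "R n = integral {0..T} (\<lambda>t. cis (of_int n * om * (d - t)) * r t)" for n :: int
  define c where "c n = cis (of_int n * om * d) * integral {0..T} (\<lambda>t. cis (- (of_int n * om * t)) * u t)" for n :: int
  \<comment> \<open>Here \<open>u t = u d + r t * q t\<close>, and multiplying by
    \<open>q t + 1\<close> lowers the frequency index by one. So each term is a difference of
    neighbouring values of \<open>R\<close>, apart from the constant \<open>u d\<close>, which only
    n = 0 sees.\<close>
  have step: "c n = (if n = 0 then of_real T * u d else 0) + (R (n - 1) - R n)" for n
  proof -
    have "c n = integral {0..T} (\<lambda>t. cis (of_int n * om * (d - t)) * u t)"
    proof -
      have "cis (of_int n * om * (d - t)) * u t = cis (of_int n * om * d) * (cis (- (of_int n * om * t)) * u t)" for t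
        by (simp add: cis_mult mult.assoc[symmetric] right_diff_distrib)
      then show ?thesis by (simp only: c_def integral_mult_right)
    qed
    also have "\<dots> = integral {0..T} (\<lambda>t. cis (of_int (- n) * om * (t - d)) * u d +
         (cis (of_int (n - 1) * om * (d - t)) * r t - cis (of_int n * om * (d - t)) * r t))"
    proof (rule integral_cong)
      fix t assume t: "t \<in> {0..T}"
      have *: "r t * q t = u t - u d" using q0[OF t] by (auto simp: r_def q_def)
      have "cis (of_int (n - 1) * om * (d - t)) = cis (of_int n * om * (d - t)) * cis (om * (t - d))"
        by (simp add: cis_mult algebra_simps)
      then have "cis (of_int (n - 1) * om * (d - t)) * r t - cis (of_int n * om * (d - t)) * r t =
        cis (of_int n * om * (d - t)) * (r t * q t)" by (simp add: q_def algebra_simps)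
      moreover have "of_int (- n) * om * (t - d) = of_int n * om * (d - t)" by (simp add: algebra_simps)
      ultimately show "cis (of_int n * om * (d - t)) * u t = cis (of_int (- n) * om * (t - d)) * u d +
         (cis (of_int (n - 1) * om * (d - t)) * r t - cis (of_int n * om * (d - t)) * r t)"
        by (simp only: *) (simp add: algebra_simps)
    qed
    also have "\<dots> = integral {0..T} (\<lambda>t. cis (of_int (- n) * om * (t - d))) * u d + (R (n - 1) - R n)"
      unfolding R_def
      by (subst integral_add, (intro integrable_continuous_real continuous_intros contr)+)
        (subst integral_diff, (intro integrable_continuous_real continuous_intros contr)+, simp only: integral_mult_left)
    also have "integral {0..T} (\<lambda>t. cis (of_int (- n) * om * (t - d))) = (if n = 0 then of_real T else 0)"
      unfolding om_def integral_cis_full_period[OF T] by simp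
    finally show ?thesis by simp
  qed
  have sum: "(\<Sum>n\<in>{- int N..int N}. c n) = of_real T * u d + (R (- 1 - int N) - R (int N))" for N
  proof (induction N)
    case 0 then show ?case by (simp add: step)
  next
    case (Suc N)
    have "{- int (Suc N)..int (Suc N)} = insert (- int (Suc N)) (insert (int (Suc N)) {- int N..int N})"
      by auto
    then show ?case using Suc by (simp add: step algebra_simps)
  qed
  have lim: "((\<lambda>N. R (k N)) \<longlongrightarrow> 0) sequentially"
    if k: "filterlim (\<lambda>N. - (of_int (k N) * om)) at_infinity sequentially" for k :: "nat \<Rightarrow> int"
  proof -
    have "((\<lambda>N. integral {0..T} (\<lambda>t. cis (- (of_int (k N) * om) * t) * r t)) \<longlongrightarrow> 0) sequentially"
      using filterlim_compose[OF Riemann_Lebesgue_continuous[OF _ contr] k] T by simp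
    then have "((\<lambda>N. norm (integral {0..T} (\<lambda>t. cis (- (of_int (k N) * om) * t) * r t))) \<longlongrightarrow> 0) sequentially"
      by (simp add: tendsto_norm_zero)
    \<comment> \<open>The shift by d contributes only a unimodular factor.\<close>
    moreover have "norm (R n) = norm (integral {0..T} (\<lambda>t. cis (- (of_int n * om) * t) * r t))" for n
    proof -
      have "R n = cis (of_int n * om * d) * integral {0..T} (\<lambda>t. cis (- (of_int n * om) * t) * r t)"
      proof -
        have "cis (of_int n * om * (d - t)) * r t = cis (of_int n * om * d) * (cis (- (of_int n * om) * t) * r t)" for t
          by (simp add: cis_mult mult.assoc[symmetric] right_diff_distrib)
        then show ?thesis by (simp only: R_def integral_mult_right)
      qed
      then show ?thesis by (simp add: norm_mult)
    qed
    ultimately have "((\<lambda>N. norm (R (k N))) \<longlongrightarrow> 0) sequentially" by simp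
    then show ?thesis by (rule tendsto_norm_zero_cancel)
  qed
  have "(\<lambda>N. R (- 1 - int N)) \<longlonglongrightarrow> 0"
  proof (rule lim)
    have "filterlim (\<lambda>N. (1 + real N) * om) at_top sequentially"
      by (rule filterlim_at_top_mult_tendsto_pos[OF tendsto_const om])
        (rule filterlim_tendsto_add_at_top[OF tendsto_const filterlim_real_sequentially])
    then show "filterlim (\<lambda>N. - (of_int (- 1 - int N) * om)) at_infinity sequentially"
      by (intro filterlim_at_top_imp_at_infinity) (simp add: algebra_simps)
  qed
  moreover have "(\<lambda>N. R (int N)) \<longlonglongrightarrow> 0"
  proof (rule lim)
    have "filterlim (\<lambda>N. - (real N * om)) at_bot sequentially"
      unfolding filterlim_uminus_at_bot minus_minus
      by (rule filterlim_at_top_mult_tendsto_pos[OF tendsto_const om filterlim_real_sequentially])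
    then show "filterlim (\<lambda>N. - (of_int (int N) * om)) at_infinity sequentially"
      by (intro filterlim_at_bot_imp_at_infinity) simp
  qed
  ultimately have "(\<lambda>N. of_real T * u d + (R (- 1 - int N) - R (int N))) \<longlonglongrightarrow> of_real T * u d + (0 - 0)"
    by (intro tendsto_intros)
  then show ?thesis
    unfolding bilateral_sums_def sum[unfolded c_def om_def, simplified, symmetric]
    by (simp add: sum[symmetric] c_def om_def)
qed

section \<open>Fourier integrals of real curves over one period\<close>

definition fourier_integral :: "real \<Rightarrow> real \<Rightarrow> (real \<Rightarrow> real) \<Rightarrow> complex" where
  "fourier_integral T w u = integral {0..T} (\<lambda>t. cis (- (w * t)) * of_real (u t))"

lemma fourier_integral_add:
  assumes "continuous_on {0..T} u" "continuous_on {0..T} v"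
  shows "fourier_integral T w (\<lambda>t. u t + v t) = fourier_integral T w u + fourier_integral T w v"
  unfolding fourier_integral_def of_real_add distrib_left
  by (intro integral_add integrable_continuous_real continuous_intros assms)

lemma fourier_integral_cmult:
  "fourier_integral T w (\<lambda>t. c * u t) = of_real c * fourier_integral T w u"
  unfolding fourier_integral_def of_real_mult mult.left_commute[of _ "of_real c"]
  by (rule integral_mult_right)

lemma fourier_integral_sum:
  assumes "finite A" "\<And>k. k \<in> A \<Longrightarrow> continuous_on {0..T} (u k)"
  shows "fourier_integral T w (\<lambda>t. \<Sum>k\<in>A. u k t) = (\<Sum>k\<in>A. fourier_integral T w (u k))"
  unfolding fourier_integral_def of_real_sum sum_distrib_left
  by (intro integral_sum integrable_continuous_real continuous_intros assms)

text \<open>Integration by parts turns differentiation into multiplication by i w. The boundary term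
  u 0 - u T stays because u need not be periodic; later it carries the impulse that drives the
  circuit.\<close>

lemma fourier_integral_deriv:
  assumes T: "T \<ge> 0" and u: "\<And>t. (u has_real_derivative u' t) (at t)"
    and cont: "continuous_on {0..T} u'" and period: "cis (w * T) = 1"
  shows "\<i> * of_real w * fourier_integral T w u = fourier_integral T w u' + of_real (u 0 - u T)"
proof -
  have cu: "continuous_on {0..T} u"
    using u by (intro continuous_at_imp_continuous_on ballI DERIV_isCont)
  define U where "U t = complex_of_real (u t)" for t
  have dU: "(U has_derivative (\<lambda>h. of_real (h * u' t))) (at t within S)" for t S
    unfolding U_def using u[of t, THEN has_field_derivative_at_within, of S]
    by (intro has_derivative_of_real) (simp add: has_field_derivative_def mult.commute[of _ "u' t"])
  have "((\<lambda>t. cis (- (w * t)) * of_real (u' t) - \<i> * of_real w * (cis (- (w * t)) * U t))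
      has_integral (cis (- (w * T)) * U T - cis (- (w * 0)) * U 0)) {0..T}"
    by (rule fundamental_theorem_of_calculus[OF T])
      (auto simp: has_vector_derivative_def scaleR_conv_of_real algebra_simps fun_eq_iff
        intro!: derivative_eq_intros dU)
  moreover have "((\<lambda>t. cis (- (w * t)) * of_real (u' t) - \<i> * of_real w * (cis (- (w * t)) * U t))
      has_integral (fourier_integral T w u' - \<i> * of_real w * fourier_integral T w u)) {0..T}"
    unfolding fourier_integral_def U_def
    by (intro has_integral_diff has_integral_mult_right integrable_integral
         integrable_continuous_real continuous_intros cu cont)
  ultimately have "fourier_integral T w u' - \<i> * of_real w * fourier_integral T w u =
      cis (- (w * T)) * of_real (u T) - cis (- (w * 0)) * of_real (u 0)"
    unfolding U_def by (rule has_integral_unique[rotated])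
  moreover have "cis (- (w * T)) = 1" using period by (simp add: cis_cnj[symmetric])
  ultimately show ?thesis by (simp add: algebra_simps)
qed

text \<open>The Fourier integrals are T times the Fourier coefficients, whence the factor T in the
  sum. The curve may jump between T and 0, as the pointwise theorem asks for a derivative only at
  the interior point d.\<close>

lemma fourier_integral_series:
  assumes "0 < d" "d < T" and u: "\<And>t. (u has_real_derivative u' t) (at t)"
  shows "bilateral_sums (\<lambda>n. cis (of_int n * (2 * pi / T) * d) *
           fourier_integral T (of_int n * (2 * pi / T)) u) (of_real (T * u d))"
proof -
  have "continuous_on {0..T} u"
    using u by (intro continuous_at_imp_continuous_on ballI DERIV_isCont)
  moreover have "((\<lambda>t. complex_of_real (u t)) has_vector_derivative of_real (u' d)) (at d)"
    by (intro has_vector_derivative_of_real u)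
  ultimately show ?thesis
    using Fourier_series_pointwise[OF assms(1,2), of "\<lambda>t. of_real (u t)"]
    by (simp add: fourier_integral_def continuous_on_of_real)
qed

text \<open>Inversion is available only at interior points; the value at 0 follows by continuity
  from the right.\<close>

lemma fourier_integral_eq_0_imp_eq_0:
  assumes T: "0 < T" and u: "\<And>t. (u has_real_derivative u' t) (at t)"
    and zero: "\<And>n::int. fourier_integral T (of_int n * (2 * pi / T)) u = 0"
  shows "u 0 = 0"
proof -
  have "u t = 0" if "0 < t" "t < T" for t
  proof -
    have "bilateral_sums (\<lambda>n. 0) (of_real (T * u t))"
      using fourier_integral_series[OF that u] unfolding zero by simp
    then show ?thesis using T by (simp add: bilateral_sums_def LIMSEQ_const_iff)
  qed
  then have "\<forall>\<^sub>F t in at_right 0. u t = 0"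
    using T by (auto simp: eventually_at_right)
  then have "(u \<longlongrightarrow> 0) (at_right 0)"
    by (simp add: tendsto_eventually)
  moreover have "(u \<longlongrightarrow> u 0) (at_right 0)"
    using DERIV_isCont[OF u, of 0] by (simp add: isCont_def filterlim_at_split)
  ultimately show ?thesis using tendsto_unique[of "at_right (0::real)" u] by simp
qed

subsection \<open>Linear flows\<close>

text \<open>The exponential of t f applied to x. Keeping t ^ k apart from the coefficient vector
  makes every component an ordinary power series in t.\<close>

definition linear_flow :: "('a::euclidean_space \<Rightarrow> 'a) \<Rightarrow> real \<Rightarrow> 'a \<Rightarrow> 'a" where
  "linear_flow f t x = (\<Sum>k. t ^ k *\<^sub>R ((f ^^ k) x /\<^sub>R fact k))"

context
  fixes f :: "'a::euclidean_space \<Rightarrow> 'a"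
  assumes lin: "linear f"
begin

text \<open>With B an operator bound for f, the series is dominated by the exponential series of |t|
  B.\<close>

lemma summable_linear_flow: "summable (\<lambda>k. t ^ k *\<^sub>R ((f ^^ k) x /\<^sub>R fact k))"
proof -
  obtain B where B: "B > 0" "\<And>x. norm (f x) \<le> B * norm x"
    using linear_bounded_pos[OF lin] by blast
  have fk: "norm ((f ^^ k) x) \<le> B ^ k * norm x" for k
  proof (induction k)
    case (Suc k)
    have "norm (f ((f ^^ k) x)) \<le> B * norm ((f ^^ k) x)" by (rule B)
    also have "\<dots> \<le> B * (B ^ k * norm x)" using Suc B by (intro mult_left_mono) auto
    finally show ?case by (simp add: mult.assoc)
  qed simp
  have "summable (\<lambda>k. norm x * (inverse (fact k) * (\<bar>t\<bar> * B) ^ k))"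
    by (intro summable_mult summable_exp)
  then show ?thesis
  proof (rule summable_comparison_test'[where N = 0])
    fix k :: nat
    have "norm (t ^ k *\<^sub>R ((f ^^ k) x /\<^sub>R fact k)) = \<bar>t\<bar> ^ k * inverse (fact k) * norm ((f ^^ k) x)"
      by (simp add: power_abs abs_mult)
    also have "\<dots> \<le> \<bar>t\<bar> ^ k * inverse (fact k) * (B ^ k * norm x)"
      by (intro mult_left_mono fk) auto
    finally show "norm (t ^ k *\<^sub>R ((f ^^ k) x /\<^sub>R fact k)) \<le> norm x * (inverse (fact k) * (\<bar>t\<bar> * B) ^ k)"
      by (simp add: power_mult_distrib mult_ac)
  qed
qed

lemma linear_flow_0 [simp]: "linear_flow f 0 x = x"
  unfolding linear_flow_def
  by (subst suminf_finite[of "{0}"]) auto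

text \<open>Each component is a real power series converging everywhere, so it may be differentiated
  termwise; f shifts the coefficients by one.\<close>

lemma linear_flow_has_vector_derivative [derivative_intros]:
  "((\<lambda>t. linear_flow f t x) has_vector_derivative f (linear_flow f t x)) (at t)"
proof -
  define a where "a k = (f ^^ k) x /\<^sub>R fact k" for k
  have sum: "summable (\<lambda>k. s ^ k *\<^sub>R a k)" for s
    using summable_linear_flow by (simp add: a_def)
  have flow: "linear_flow f s x = (\<Sum>k. s ^ k *\<^sub>R a k)" for s
    by (simp add: linear_flow_def a_def)
  have blf: "bounded_linear f" using lin by (simp add: linear_conv_bounded_linear)
  have fa: "f (a k) = real (Suc k) *\<^sub>R a (Suc k)" for k
  proof -
    have "f (a k) = f ((f ^^ k) x) /\<^sub>R fact k" unfolding a_def by (rule linear_scale[OF lin])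
    then show ?thesis by (simp add: a_def del: of_nat_Suc)
  qed
  show ?thesis
    unfolding has_vector_derivative_def
  proof (subst has_derivative_componentwise_within, rule ballI)
    fix b :: 'a assume "b \<in> Basis"
    have comp: "linear_flow f s x \<bullet> b = (\<Sum>k. (a k \<bullet> b) * s ^ k)" for s
      unfolding flow using bounded_linear.suminf[OF bounded_linear_inner_left[of b] sum[of s]]
      by (simp add: mult.commute)
    have "f (linear_flow f t x) \<bullet> b = (\<Sum>k. f (t ^ k *\<^sub>R a k) \<bullet> b)"
      unfolding flow using bounded_linear.suminf[OF bounded_linear_compose[OF bounded_linear_inner_left[of b] blf] sum[of t]]
      by simp
    also have "\<dots> = (\<Sum>k. diffs (\<lambda>k. a k \<bullet> b) k * t ^ k)"
      by (simp add: linear_scale[OF lin] fa diffs_def mult_ac del: of_nat_Suc)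
    finally have df: "f (linear_flow f t x) \<bullet> b = (\<Sum>k. diffs (\<lambda>k. a k \<bullet> b) k * t ^ k)" .
    have "summable (\<lambda>k. (a k \<bullet> b) * s ^ k)" for s
      using bounded_linear.summable[OF bounded_linear_inner_left[of b] sum[of s]] by (simp add: mult.commute)
    from termdiffs_strong_converges_everywhere[OF this, of t]
    show "((\<lambda>s. linear_flow f s x \<bullet> b) has_derivative (\<lambda>s. s *\<^sub>R f (linear_flow f t x) \<bullet> b)) (at t)"
      unfolding comp by (simp add: df has_field_derivative_def mult.commute[of _ "suminf _"])
  qed
qed

lemma linear_flow_has_real_derivative:
  fixes g :: "'a \<Rightarrow> real"
  assumes "linear g"
  shows "((\<lambda>t. g (linear_flow f t x)) has_real_derivative g (f (linear_flow f t x))) (at t)"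
  using bounded_linear.has_vector_derivative[OF _ linear_flow_has_vector_derivative, of g] assms
  by (simp add: linear_conv_bounded_linear has_real_derivative_iff_has_vector_derivative)

text \<open>Gronwall's argument for the difference u of the solutions. The inner product of u and f
  u is at most B |u|^2 in absolute value, so exp (-2 B t) |u|^2 is nonincreasing forward in time and
  exp (2 B t) |u|^2 is nondecreasing up to time 0. Both vanish at 0.\<close>

lemma linear_ode_unique:
  assumes X: "\<And>t. (X has_vector_derivative f (X t)) (at t)"
    and Y: "\<And>t. (Y has_vector_derivative f (Y t)) (at t)" and "X 0 = Y 0"
  shows "X t = Y t"
proof -
  define u where "u t = X t - Y t" for t
  have u: "(u has_vector_derivative f (u t)) (at t)" for t
    unfolding u_def by (auto intro!: derivative_eq_intros X Y simp: linear_diff[OF lin])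
  have u0: "u 0 = 0" using assms by (simp add: u_def)
  obtain B where B: "B > 0" "\<And>x. norm (f x) \<le> B * norm x"
    using linear_bounded_pos[OF lin] by blast
  have duu: "((\<lambda>t. u t \<bullet> u t) has_real_derivative 2 * (u t \<bullet> f (u t))) (at t)" for t
  proof -
    have "((\<lambda>t. u t \<bullet> u t) has_derivative (\<lambda>h. u t \<bullet> (h *\<^sub>R f (u t)) + (h *\<^sub>R f (u t)) \<bullet> u t)) (at t)"
      by (intro has_derivative_inner) (use u in \<open>auto simp: has_vector_derivative_def\<close>)
    moreover have "(\<lambda>h. u t \<bullet> (h *\<^sub>R f (u t)) + (h *\<^sub>R f (u t)) \<bullet> u t) = (*) (2 * (u t \<bullet> f (u t)))"
      by (auto simp: fun_eq_iff inner_commute)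
    ultimately show ?thesis by (simp add: has_field_derivative_def)
  qed
  have bnd: "\<bar>u t \<bullet> f (u t)\<bar> \<le> B * (u t \<bullet> u t)" for t
  proof -
    have "\<bar>u t \<bullet> f (u t)\<bar> \<le> norm (u t) * norm (f (u t))" by (rule Cauchy_Schwarz_ineq2)
    also have "\<dots> \<le> norm (u t) * (B * norm (u t))" by (intro mult_left_mono B) auto
    finally show ?thesis by (simp add: power2_norm_eq_inner[symmetric] power2_eq_square mult_ac)
  qed
  define g where "g c t = exp (c * t) * (u t \<bullet> u t)" for c t
  have dg: "(g c has_real_derivative exp (c * t) * (c * (u t \<bullet> u t) + 2 * (u t \<bullet> f (u t)))) (at t)" for c t
    unfolding g_def by (auto intro!: derivative_eq_intros duu simp: algebra_simps)
  have "u t \<bullet> u t \<le> 0"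
  proof (cases "t \<ge> 0")
    case True
    have "g (- 2 * B) t \<le> g (- 2 * B) 0"
    proof (rule DERIV_nonpos_imp_nonincreasing[OF True])
      fix s
      have "- 2 * B * (u s \<bullet> u s) + 2 * (u s \<bullet> f (u s)) \<le> 0" using bnd[of s] by (simp add: abs_le_iff)
      then show "\<exists>y. (g (- 2 * B) has_real_derivative y) (at s) \<and> y \<le> 0"
        by (intro exI conjI) (rule dg, rule mult_nonneg_nonpos, auto)
    qed
    then show ?thesis using u0 by (simp add: g_def mult_le_0_iff)
  next
    case False
    have "g (2 * B) t \<le> g (2 * B) 0"
    proof (rule DERIV_nonneg_imp_nondecreasing[where f = "g (2 * B)" and a = t and b = 0])
      show "t \<le> 0" using False by simp
      fix s
      have "0 \<le> 2 * B * (u s \<bullet> u s) + 2 * (u s \<bullet> f (u s))" using bnd[of s] by (simp add: abs_le_iff)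
      then show "\<exists>y. (g (2 * B) has_real_derivative y) (at s) \<and> 0 \<le> y"
        by (intro exI conjI) (rule dg, rule mult_nonneg_nonneg, auto)
    qed
    then show ?thesis using u0 by (simp add: g_def mult_le_0_iff)
  qed
  then have "u t \<bullet> u t = 0" by (intro antisym) auto
  then show ?thesis by (simp add: u_def)
qed

text \<open>The principle behind the laws below: linearity, the group law and commutation with f
  each compare two solutions with equal initial values.\<close>

lemma linear_flow_unique:
  assumes "\<And>t. (X has_vector_derivative f (X t)) (at t)"
  shows "X t = linear_flow f t (X 0)"
  by (rule linear_ode_unique[OF assms linear_flow_has_vector_derivative]) simp

lemma linear_linear_flow: "linear (linear_flow f t)"
proof
  fix x y :: 'a and c :: real
  have "((\<lambda>t. linear_flow f t x + linear_flow f t y) has_vector_derivative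
      f (linear_flow f t x + linear_flow f t y)) (at t)" for t
    unfolding linear_add[OF lin] by (intro derivative_intros)
  from linear_flow_unique[OF this, of t]
  show "linear_flow f t (x + y) = linear_flow f t x + linear_flow f t y" by simp
  have "((\<lambda>t. c *\<^sub>R linear_flow f t x) has_vector_derivative f (c *\<^sub>R linear_flow f t x)) (at t)" for t
    unfolding linear_scale[OF lin]
    by (rule bounded_linear.has_vector_derivative[OF bounded_linear_scaleR_right linear_flow_has_vector_derivative])
  from linear_flow_unique[OF this, of t]
  show "linear_flow f t (c *\<^sub>R x) = c *\<^sub>R linear_flow f t x" by simp
qed

lemma linear_flow_add: "linear_flow f (s + t) x = linear_flow f s (linear_flow f t x)"
proof -
  have "((\<lambda>s. linear_flow f (s + t) x) has_vector_derivative f (linear_flow f (s + t) x)) (at s)" for s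
  proof -
    have "((\<lambda>s. s + t) has_vector_derivative 1) (at s)"
      by (auto intro!: derivative_eq_intros)
    from vector_diff_chain_at[OF this linear_flow_has_vector_derivative] show ?thesis
      by (simp add: o_def)
  qed
  from linear_flow_unique[of "\<lambda>s. linear_flow f (s + t) x", OF this, of s] show ?thesis by simp
qed

lemma linear_flow_commute: "linear_flow f t (f x) = f (linear_flow f t x)"
proof -
  have blf: "bounded_linear f" using lin by (simp add: linear_conv_bounded_linear)
  have "((\<lambda>t. f (linear_flow f t x)) has_vector_derivative f (f (linear_flow f t x))) (at t)" for t
    by (rule bounded_linear.has_vector_derivative[OF blf linear_flow_has_vector_derivative])
  from linear_flow_unique[of "\<lambda>t. f (linear_flow f t x)", OF this, of t] show ?thesis by simp
qed

lemma linear_flow_uminus [simp]: "linear_flow f t (linear_flow f (- t) x) = x"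
  using linear_flow_add[of t "- t" x] by simp

lemma linear_flow_eq_0_iff [simp]: "linear_flow f t x = 0 \<longleftrightarrow> x = 0"
  by (metis linear_flow_uminus linear_0[OF linear_linear_flow] minus_minus)

end

subsection \<open>Frequency response of the linearized converter\<close>

text \<open>The homogeneous part of \<open>field\<close>: both inputs, v_d and v_r, are set to zero,
  and \<open>field_eq\<close> restores them as a constant vector.\<close>

fun lin_field :: "('n::finite) buck \<Rightarrow> 'n state \<Rightarrow> 'n state" where
  "lin_field p (iL, vC, z) =
     (let vo = out_voltage p (iL, vC, z) in
       (- vo / inductance p, (iL - vo / load_res p) / capacitance p, comp_A p *v z + vo *\<^sub>R comp_B p))"

text \<open>The map K of the introduction, that is, minus the state-dependent part of y.\<close>

fun lin_out :: "('n::finite) buck \<Rightarrow> 'n state \<Rightarrow> real" where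
  "lin_out p (iL, vC, z) = comp_C p \<bullet> z + comp_D p * out_voltage p (iL, vC, z)"

definition power_den :: "('n::finite) buck \<Rightarrow> complex \<Rightarrow> complex" where
  "power_den p s = of_real (inductance p * capacitance p * (1 + esr p / load_res p)) * s\<^sup>2
      + of_real (inductance p / load_res p + esr p * capacitance p) * s + 1"

lemma field_eq:
  "field p vd x = lin_field p x + (vd / inductance p, 0, - (v_ref p *\<^sub>R comp_B p))"
  by (cases x) (simp add: Let_def algebra_simps diff_divide_distrib)

lemma comp_out_eq: "comp_out p x = v_ref p * (1 + comp_D p) - lin_out p x"
  by (cases x) (simp add: algebra_simps)

lemma linear_out_voltage: "linear (out_voltage p)"
  by (rule linearI) (auto simp: algebra_simps add_divide_distrib)

lemma linear_lin_field: "linear (lin_field p)"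
  by (rule linearI)
    (auto simp: Let_def linear_add[OF linear_out_voltage, of p "(_,_,_)" "(_,_,_)", simplified]
       algebra_simps add_divide_distrib diff_divide_distrib matrix_vector_right_distrib scaleR_matrix_vector_assoc[symmetric]
       matrix_vector_mult_scaleR)

lemma linear_lin_out: "linear (lin_out p)"
  by (rule linearI) (auto simp: algebra_simps add_divide_distrib inner_add_right)

context
  fixes p :: "('n::finite) buck"
  assumes wf: "well_formed p"
begin

text \<open>The imaginary part is w times the positive damping coefficient L / R + R_c C, and at w =
  0 the value is 1.\<close>

lemma power_den_imaginary: "power_den p (\<i> * of_real w) \<noteq> 0"
proof
  assume *: "power_den p (\<i> * of_real w) = 0"
  then have "Im (power_den p (\<i> * of_real w)) = 0" by simp
  then have "(inductance p / load_res p + esr p * capacitance p) * w = 0"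
    by (simp add: power_den_def power2_eq_square)
  moreover have "inductance p / load_res p + esr p * capacitance p > 0"
    using wf by (auto simp: well_formed_def intro!: add_pos_nonneg)
  ultimately have "w = 0" by simp
  with * show False by (simp add: power_den_def)
qed

text \<open>The Fourier integral of each state equation is the circuit equation at s, in which the
  failure of the orbit to close up (c / L in the current, z0 in the compensator) acts as the source.
  Eliminating current and capacitor voltage yields the transfer function of the power stage.\<close>

lemma lin_field_fourier:
  fixes x0 :: "'n state"
  assumes T: "T > 0" and period: "cis (w * T) = 1"
    and jump: "x0 - linear_flow (lin_field p) T x0 = (c / inductance p, 0, z0)"
  defines "X \<equiv> \<lambda>t. linear_flow (lin_field p) t x0" and "s \<equiv> \<i> * of_real w"
  shows "fourier_integral T w (\<lambda>t. out_voltage p (X t)) * power_den p s = of_real c * (s * of_real (esr p * capacitance p) + 1)"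
    and "c = 0 \<Longrightarrow> fourier_integral T w (\<lambda>t. fst (X t)) = 0"
    and "c = 0 \<Longrightarrow> fourier_integral T w (\<lambda>t. fst (snd (X t))) = 0"
    and "comp_char_matrix p s *v (\<chi> k. fourier_integral T w (\<lambda>t. snd (snd (X t)) $ k)) =
           fourier_integral T w (\<lambda>t. out_voltage p (X t)) *s (\<chi> k. of_real (comp_B p $ k)) + (\<chi> k. of_real (z0 $ k))"
proof -
  define i v vo where "i t = fst (X t)" and "v t = fst (snd (X t))" and "vo t = out_voltage p (X t)" for t
  define z where "z t = snd (snd (X t))" for t
  let ?L = "inductance p" and ?C = "capacitance p" and ?R = "load_res p" and ?Rc = "esr p"
  let ?F = "fourier_integral T w"
  have pos: "?L > 0" "?C > 0" "?R > 0" "?Rc \<ge> 0" using wf by (auto simp: well_formed_def)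
  have X: "X t = (i t, v t, z t)" for t by (simp add: i_def v_def z_def)
  have vo: "vo t = ?R / (?R + ?Rc) * v t + ?R / (?R + ?Rc) * ?Rc * i t" for t
    by (simp add: vo_def X algebra_simps add_divide_distrib)
  have dX: "(X has_vector_derivative (- vo t / ?L, (i t - vo t / ?R) / ?C, comp_A p *v z t + vo t *\<^sub>R comp_B p)) (at t)" for t
  proof -
    have "(X has_vector_derivative lin_field p (X t)) (at t)"
      unfolding X_def by (rule linear_flow_has_vector_derivative[OF linear_lin_field])
    then show ?thesis
      by (simp add: X[of t] Let_def vo_def del: out_voltage.simps)
  qed
  have di: "(i has_real_derivative (- 1 / ?L) * vo t) (at t)" for t
    using bounded_linear.has_vector_derivative[OF bounded_linear_fst dX[of t]]
    by (simp add: i_def[abs_def] has_real_derivative_iff_has_vector_derivative)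
  have dsnd: "((\<lambda>t. snd (X t)) has_vector_derivative ((i t - vo t / ?R) / ?C, comp_A p *v z t + vo t *\<^sub>R comp_B p)) (at t)" for t
    using bounded_linear.has_vector_derivative[OF bounded_linear_snd dX[of t]] by simp
  have dv: "(v has_real_derivative (1 / ?C) * i t + (- 1 / (?C * ?R)) * vo t) (at t)" for t
    using bounded_linear.has_vector_derivative[OF bounded_linear_fst dsnd[of t]] pos
    by (simp add: v_def[abs_def] has_real_derivative_iff_has_vector_derivative field_simps)
  have dz: "((\<lambda>t. z t $ k) has_real_derivative (\<Sum>j\<in>UNIV. comp_A p $ k $ j * z t $ j) + comp_B p $ k * vo t) (at t)" for t k
    using bounded_linear.has_vector_derivative[OF bounded_linear_vec_nth
       bounded_linear.has_vector_derivative[OF bounded_linear_snd dsnd[of t]], of k]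
    by (simp add: z_def[abs_def] has_real_derivative_iff_has_vector_derivative matrix_vector_mult_def mult.commute)
  have ci: "continuous_on A i" and cv: "continuous_on A v" and cz: "continuous_on A (\<lambda>t. z t $ k)" for A k
    using di dv dz by (auto intro!: continuous_at_imp_continuous_on DERIV_isCont)
  have cvo: "continuous_on A vo" for A
    unfolding vo[abs_def] by (intro continuous_intros ci cv)
  have jmp: "i 0 - i T = c / ?L" "v 0 - v T = 0" "z 0 - z T = z0"
    using jump by (auto simp: i_def v_def z_def X_def linear_flow_0[OF linear_lin_field] fst_diff[symmetric] snd_diff[symmetric] simp del: fst_diff snd_diff)
  have Fi: "s * ?F i = of_real (- 1 / ?L) * ?F vo + of_real (c / ?L)"
  proof -
    have "continuous_on {0..T} (\<lambda>t. (- 1 / ?L) * vo t)" by (intro continuous_on_mult_left cvo)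
    from fourier_integral_deriv[OF less_imp_le[OF T] di this period]
    show ?thesis unfolding s_def jmp fourier_integral_cmult .
  qed
  have Fv: "s * ?F v = of_real (1 / ?C) * ?F i + of_real (- 1 / (?C * ?R)) * ?F vo"
  proof -
    have c: "continuous_on {0..T} (\<lambda>t. (1 / ?C) * i t)" "continuous_on {0..T} (\<lambda>t. (- 1 / (?C * ?R)) * vo t)"
      by (intro continuous_on_mult_left cvo ci)+
    from fourier_integral_deriv[OF less_imp_le[OF T] dv continuous_on_add[OF this] period]
    show ?thesis unfolding s_def jmp fourier_integral_add[OF c] fourier_integral_cmult by simp
  qed
  have Fz: "s * ?F (\<lambda>t. z t $ k) = (\<Sum>j\<in>UNIV. of_real (comp_A p $ k $ j) * ?F (\<lambda>t. z t $ j)) +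
      of_real (comp_B p $ k) * ?F vo + of_real (z0 $ k)" for k
  proof -
    have c: "continuous_on {0..T} (\<lambda>t. comp_A p $ k $ j * z t $ j)" for j
      by (intro continuous_on_mult_left cz)
    then have c1: "continuous_on {0..T} (\<lambda>t. \<Sum>j\<in>UNIV. comp_A p $ k $ j * z t $ j)"
      by (intro continuous_on_sum)
    have c2: "continuous_on {0..T} (\<lambda>t. comp_B p $ k * vo t)"
      by (intro continuous_on_mult_left cvo)
    have "z 0 $ k - z T $ k = z0 $ k" unfolding jmp(3)[symmetric] by simp
    with fourier_integral_deriv[OF less_imp_le[OF T] dz continuous_on_add[OF c1 c2] period]
    show ?thesis
      unfolding s_def fourier_integral_add[OF c1 c2] fourier_integral_cmult
        fourier_integral_sum[OF finite c] by simp
  qed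
  have Fo: "?F vo = of_real (?R / (?R + ?Rc)) * ?F v + of_real (?R / (?R + ?Rc) * ?Rc) * ?F i"
    unfolding vo[abs_def]
    by (subst fourier_integral_add) (intro continuous_on_mult_left cv ci, intro continuous_on_mult_left cv ci, simp only: fourier_integral_cmult)
  have Fi': "of_real ?L * s * ?F i = of_real c - ?F vo"
    using Fi pos by (simp add: field_simps)
  have Fv': "of_real ?C * s * ?F v = ?F i - ?F vo / of_real ?R"
    using Fv pos by (simp add: field_simps)
  \<comment> \<open>Multiplying the output equation by 1 + R_c / R, the inverse of \<open>k\<close>,
    removes the voltage divider and produces the factor in the leading coefficient of
    \<open>power_den\<close>.\<close>
  define k where "k = ?R / (?R + ?Rc)"
  have "1 + ?Rc / ?R = (?R + ?Rc) / ?R" using pos by (simp add: add_divide_distrib)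
  then have k: "(1 + ?Rc / ?R) * k = 1" using pos by (simp add: k_def)
  have "of_real (1 + ?Rc / ?R) * ?F vo = of_real ((1 + ?Rc / ?R) * k) * ?F v + of_real (((1 + ?Rc / ?R) * k) * ?Rc) * ?F i"
    unfolding Fo k_def[symmetric] of_real_mult by (simp only: distrib_left mult.assoc)
  then have Fo': "of_real (1 + ?Rc / ?R) * ?F vo = ?F v + of_real ?Rc * ?F i"
    unfolding k by simp
  have "?F vo * power_den p s = (of_real ?L * of_real ?C * s\<^sup>2) * (of_real (1 + ?Rc / ?R) * ?F vo)
      + of_real (?L / ?R + ?Rc * ?C) * s * ?F vo + ?F vo"
    by (simp add: power_den_def algebra_simps)
  also have "(of_real ?L * of_real ?C * s\<^sup>2) * (of_real (1 + ?Rc / ?R) * ?F vo) =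
      of_real ?L * s * (of_real ?C * s * ?F v) + of_real ?Rc * of_real ?C * s * (of_real ?L * s * ?F i)"
    unfolding Fo' by (simp add: algebra_simps power2_eq_square)
  also have "\<dots> = (of_real ?L * s * ?F i) - of_real ?L * s * ?F vo / of_real ?R + of_real ?Rc * of_real ?C * s * (of_real ?L * s * ?F i)"
    unfolding Fv' by (simp add: algebra_simps)
  also have "\<dots> = (of_real c - ?F vo) - of_real ?L * s * ?F vo / of_real ?R + of_real ?Rc * of_real ?C * s * (of_real c - ?F vo)"
    unfolding Fi' ..
  finally have main: "?F vo * power_den p s = of_real c * (s * of_real (?Rc * ?C) + 1)"
    by (simp add: algebra_simps add_divide_distrib)
  then show "?F (\<lambda>t. out_voltage p (X t)) * power_den p s = of_real c * (s * of_real (?Rc * ?C) + 1)"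
    by (simp add: vo_def[abs_def])
  have zero: "?F i = 0 \<and> ?F v = 0" if "c = 0"
  proof -
    have "?F vo = 0" using main power_den_imaginary[of w] that by (simp add: s_def)
    \<comment> \<open>At s = 0 the inductor equation \<open>Fi'\<close> is void, so the current
      comes from the capacitor equation \<open>Fv'\<close>; for other s it comes from
      \<open>Fi'\<close>. The output equation \<open>Fo'\<close> then gives the voltage.\<close>
    then show ?thesis using Fi' Fv' Fo' pos that by (cases "s = 0") auto
  qed
  then show "c = 0 \<Longrightarrow> ?F (\<lambda>t. fst (X t)) = 0" "c = 0 \<Longrightarrow> ?F (\<lambda>t. fst (snd (X t))) = 0"
    by (auto simp: i_def[abs_def] v_def[abs_def])
  show "comp_char_matrix p s *v (\<chi> k. ?F (\<lambda>t. snd (snd (X t)) $ k)) =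
           ?F (\<lambda>t. out_voltage p (X t)) *s (\<chi> k. of_real (comp_B p $ k)) + (\<chi> k. of_real (z0 $ k))"
    unfolding vo_def[symmetric] z_def[symmetric] vec_eq_iff
  proof
    fix k
    have "(comp_char_matrix p s *v (\<chi> k. ?F (\<lambda>t. z t $ k))) $ k =
        (\<Sum>j\<in>UNIV. (if k = j then s else 0) * ?F (\<lambda>t. z t $ j)) - (\<Sum>j\<in>UNIV. of_real (comp_A p $ k $ j) * ?F (\<lambda>t. z t $ j))"
      by (simp add: comp_char_matrix_def matrix_vector_mult_def mat_def left_diff_distrib sum_subtractf)
    also have "(\<Sum>j\<in>UNIV. (if k = j then s else 0) * ?F (\<lambda>t. z t $ j)) = s * ?F (\<lambda>t. z t $ k)"
      by (subst sum.mono_neutral_right[of UNIV "{k}"]) auto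
    finally show "(comp_char_matrix p s *v (\<chi> k. ?F (\<lambda>t. z t $ k))) $ k =
        (?F (\<lambda>t. vo t) *s (\<chi> k. of_real (comp_B p $ k)) + (\<chi> k. of_real (z0 $ k))) $ k"
      unfolding Fz by (simp add: mult.commute)
  qed
qed

end

lemma matrix_inv_mult_vector:
  fixes A :: "'a::field ^ 'n ^ 'n"
  assumes "det A \<noteq> 0" "A *v x = y"
  shows "x = matrix_inv A *v y"
proof -
  have "\<exists>A'. A ** A' = mat 1 \<and> A' ** A = mat 1"
    using assms(1) by (simp add: invertible_det_nz[symmetric] invertible_def)
  then have "matrix_inv A ** A = mat 1"
    unfolding matrix_inv_def by (rule someI2_ex) simp
  then show ?thesis
    using assms(2) by (metis matrix_vector_mul_assoc matrix_vector_mul_lid)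
qed

section \<open>Periodic orbits and the harmonic gain\<close>

context
  fixes p :: "('n::finite) buck"
  assumes wf: "well_formed p"
begin

lemma harmonic_period: "T > 0 \<Longrightarrow> cis (of_int n * (2 * pi / T) * T) = 1"
  using cis_multiple_2pi[of "of_int n"] by (simp add: mult.commute)

text \<open>A closed orbit has no jump, so all Fourier integrals of current and capacitor voltage
  vanish. T is left free because the result is also applied to differences of switching
  instants.\<close>

lemma periodic_imp_power_stage_0:
  assumes T: "T > 0" and per: "linear_flow (lin_field p) T x = x"
  shows "fst x = 0" "fst (snd x) = 0"
proof -
  have jump: "x - linear_flow (lin_field p) T x = (0 / inductance p, 0, 0)"
    using per by (simp add: zero_prod_def)
  have lin: "linear (\<lambda>x :: 'n state. fst x)" "linear (\<lambda>x :: 'n state. fst (snd x))"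
    by (auto intro!: linearI)
  note zero = lin_field_fourier(2,3)[OF wf T harmonic_period[OF T] jump refl]
  show "fst x = 0"
    using fourier_integral_eq_0_imp_eq_0[OF T linear_flow_has_real_derivative[OF linear_lin_field lin(1)] zero(1)]
    by (simp add: linear_flow_0[OF linear_lin_field])
  show "fst (snd x) = 0"
    using fourier_integral_eq_0_imp_eq_0[OF T linear_flow_has_real_derivative[OF linear_lin_field lin(2)] zero(2)]
    by (simp add: linear_flow_0[OF linear_lin_field])
qed

context
  assumes poles: "no_harmonic_poles p"
begin

lemma char_matrix_harmonic:
  "det (comp_char_matrix p (\<i> * of_real (of_int n * (2 * pi / period p)))) \<noteq> 0"
  using poles[unfolded no_harmonic_poles_def, rule_format, of n]
  by (simp add: switching_freq_def mult.assoc)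

text \<open>This is the injectivity of \<open>id - \<Phi>\<^sub>T\<close>. The output voltage has
  vanishing harmonics, so the compensator receives no input, and its characteristic matrix is
  invertible at every harmonic.\<close>

lemma periodic_imp_0:
  assumes per: "linear_flow (lin_field p) (period p) x = x"
  shows "x = 0"
proof -
  have T: "period p > 0" using wf by (simp add: well_formed_def)
  have jump: "x - linear_flow (lin_field p) (period p) x = (0 / inductance p, 0, 0)"
    using per by (simp add: zero_prod_def)
  have "snd (snd x) $ k = 0" for k
  proof -
    have lin: "linear (\<lambda>x :: 'n state. snd (snd x) $ k)"
      by (auto intro!: linearI)
    have zero: "fourier_integral (period p) (of_int n * (2 * pi / period p))
        (\<lambda>t. snd (snd (linear_flow (lin_field p) t x)) $ k) = 0" for n
    proof -
      note F = lin_field_fourier[OF wf T harmonic_period[OF T, of n] jump]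
      have "fourier_integral (period p) (of_int n * (2 * pi / period p))
        (\<lambda>t. out_voltage p (linear_flow (lin_field p) t x)) = 0"
        using F(1) power_den_imaginary[OF wf] by (metis mult_eq_0_iff mult_zero_left of_real_0)
      then have "comp_char_matrix p (\<i> * of_real (of_int n * (2 * pi / period p))) *v
          (\<chi> k. fourier_integral (period p) (of_int n * (2 * pi / period p))
             (\<lambda>t. snd (snd (linear_flow (lin_field p) t x)) $ k)) = 0"
        using F(4) by (simp add: vec_eq_iff)
      from matrix_inv_mult_vector[OF char_matrix_harmonic this] show ?thesis
        by (simp add: vec_eq_iff)
    qed
    show ?thesis
      using fourier_integral_eq_0_imp_eq_0[OF T linear_flow_has_real_derivative[OF linear_lin_field lin] zero]
      by (simp add: linear_flow_0[OF linear_lin_field])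
  qed
  then show ?thesis
    using periodic_imp_power_stage_0[OF T per] by (auto simp: prod_eq_iff vec_eq_iff)
qed

text \<open>The orbit of x is the periodic response to impulses of strength c in v_d, one per
  period. All harmonics of such a train are equal, so those of the output sample the loop
  gain.\<close>

lemma lin_out_fourier:
  assumes jump: "x - linear_flow (lin_field p) (period p) x = (c / inductance p, 0, 0)"
  shows "fourier_integral (period p) (of_int n * (2 * pi / period p)) (\<lambda>t. lin_out p (linear_flow (lin_field p) t x))
    = of_real c * HB_gain p (\<i> * of_int n * of_real (switching_freq p))"
proof -
  define T where "T = period p"
  have T: "T > 0" using wf by (simp add: well_formed_def T_def)
  define w where "w = of_int n * (2 * pi / T)"
  define s where "s = \<i> * complex_of_real w"
  have s: "\<i> * of_int n * of_real (switching_freq p) = s"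
    by (simp add: s_def w_def switching_freq_def T_def)
  define X where "X t = linear_flow (lin_field p) t x" for t
  define Z where "Z k = fourier_integral T w (\<lambda>t. snd (snd (X t)) $ k)" for k
  define V where "V = fourier_integral T w (\<lambda>t. out_voltage p (X t))"
  note F = lin_field_fourier[OF wf T, of w x c 0, folded X_def s_def V_def Z_def]
  have per: "cis (w * T) = 1" unfolding w_def by (rule harmonic_period[OF T])
  have jump': "x - X T = (c / inductance p, 0, 0)" using jump by (simp add: X_def T_def)
  have cont: "continuous_on A (\<lambda>t. g (X t))" if "linear g" for g :: "'n state \<Rightarrow> real" and A
    unfolding X_def
    using linear_flow_has_real_derivative[OF linear_lin_field that]
    by (intro continuous_at_imp_continuous_on ballI DERIV_isCont)
  have cz: "continuous_on A (\<lambda>t. snd (snd (X t)) $ k)" for A k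
    by (rule cont) (auto intro!: linearI)
  have cv: "continuous_on A (\<lambda>t. out_voltage p (X t))" for A
    by (rule cont[OF linear_out_voltage])
  have out: "lin_out p y = (\<Sum>k\<in>UNIV. comp_C p $ k * snd (snd y) $ k) + comp_D p * out_voltage p y" for y
    by (cases y) (simp add: inner_vec_def)
  have c1: "continuous_on {0..T} (\<lambda>t. comp_C p $ k * snd (snd (X t)) $ k)" for k
    by (intro continuous_on_mult_left cz)
  have c2: "continuous_on {0..T} (\<lambda>t. comp_D p * out_voltage p (X t))"
    by (intro continuous_on_mult_left cv)
  have "fourier_integral T w (\<lambda>t. lin_out p (X t)) =
      (\<Sum>k\<in>UNIV. of_real (comp_C p $ k) * Z k) + of_real (comp_D p) * V"
    unfolding out fourier_integral_add[OF continuous_on_sum[OF c1] c2] fourier_integral_cmult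
      fourier_integral_sum[OF finite c1] Z_def V_def ..
  moreover have "Z k = V * (matrix_inv (comp_char_matrix p s) *v (\<chi> k. of_real (comp_B p $ k))) $ k" for k
  proof -
    have "comp_char_matrix p s *v (\<chi> k. Z k) = V *s (\<chi> k. of_real (comp_B p $ k))"
      using F(4)[OF per jump'] by (simp add: vec_eq_iff Z_def[abs_def])
    moreover have "det (comp_char_matrix p s) \<noteq> 0"
      using char_matrix_harmonic[of n] by (simp add: s_def w_def T_def)
    ultimately have "(\<chi> k. Z k) = matrix_inv (comp_char_matrix p s) *v (V *s (\<chi> k. of_real (comp_B p $ k)))"
      by (intro matrix_inv_mult_vector)
    then show ?thesis by (simp add: vec_eq_iff matrix_vector_mult_def sum_distrib_left mult_ac)
  qed
  ultimately have "fourier_integral T w (\<lambda>t. lin_out p (X t)) = G_c p s * V"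
    by (simp add: G_c_def sum_distrib_left distrib_left mult_ac)
  moreover have "V = of_real c * (G_vd p s / of_real (v_source p))"
  proof -
    have cancel: "a * b / c / a = b / c" if "a \<noteq> 0" for a b c :: complex
      using that by simp
    have "complex_of_real (v_source p) \<noteq> 0" using wf by (simp add: well_formed_def)
    then have G: "G_vd p s / of_real (v_source p) = (s * of_real (esr p * capacitance p) + 1) / power_den p s"
      unfolding G_vd_def power_den_def by (rule cancel)
    have nz: "power_den p s \<noteq> 0" unfolding s_def by (rule power_den_imaginary[OF wf])
    have "V = of_real c * (s * of_real (esr p * capacitance p) + 1) / power_den p s"
      unfolding nonzero_eq_divide_eq[OF nz] by (rule F(1)[OF per jump'])
    then show ?thesis unfolding G by (simp only: times_divide_eq_right)
  qed
  ultimately show ?thesis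
    unfolding s by (simp add: HB_gain_def X_def w_def T_def)
qed

end
end

subsection \<open>The sampled map\<close>

text \<open>Compactness makes the inverse of F continuous on its image, so \<tau> is continuous at
  x0. Projecting F onto w gives a scalar function with derivative 1 at \<open>\<tau> x0\<close>;
  dividing by its Caratheodory slope recovers the difference quotient of \<tau>.\<close>

lemma has_real_derivative_through_injective_curve:
  fixes F :: "real \<Rightarrow> 'a::euclidean_space"
  assumes cont: "continuous_on {a..b} F" and inj: "inj_on F {a..b}"
    and tau: "\<And>x. \<tau> x \<in> {a..b}"
    and dF: "(F has_vector_derivative w) (at (\<tau> x0))" and w: "w \<noteq> 0"
    and comp: "((\<lambda>x. F (\<tau> x)) has_vector_derivative v) (at x0)"
  obtains l where "(\<tau> has_real_derivative l) (at x0)"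
proof -
  have "continuous_on (F ` {a..b}) (inv_into {a..b} F)"
    using inj by (intro continuous_on_inv cont) auto
  moreover have "((\<lambda>x. F (\<tau> x)) \<longlongrightarrow> F (\<tau> x0)) (at x0)"
    using has_vector_derivative_continuous[OF comp] by (simp add: isCont_def)
  ultimately have "((\<lambda>x. inv_into {a..b} F (F (\<tau> x))) \<longlongrightarrow> inv_into {a..b} F (F (\<tau> x0))) (at x0)"
    by (rule continuous_on_tendsto_compose) (use tau in auto)
  then have ct: "isCont \<tau> x0" using tau inj by (simp add: isCont_def)
  define m where "m t = F t \<bullet> w / (w \<bullet> w)" for t
  have bl: "bounded_linear (\<lambda>x. x \<bullet> w / (w \<bullet> w))"
    by (intro bounded_linear_divide bounded_linear_inner_left bounded_linear_compose[OF bounded_linear_divide bounded_linear_inner_left])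
  have "(m has_real_derivative 1) (at (\<tau> x0))"
    using bounded_linear.has_vector_derivative[OF bl dF] w
    by (simp add: m_def[abs_def] has_real_derivative_iff_has_vector_derivative)
  then obtain M where M: "\<And>z. m z - m (\<tau> x0) = M z * (z - \<tau> x0)" "isCont M (\<tau> x0)" "M (\<tau> x0) = 1"
    unfolding CARAT_DERIV by blast
  define l where "l = v \<bullet> w / (w \<bullet> w)"
  have "((\<lambda>x. m (\<tau> x)) has_real_derivative l) (at x0)"
    using bounded_linear.has_vector_derivative[OF bl comp]
    by (simp add: m_def[abs_def] l_def has_real_derivative_iff_has_vector_derivative)
  then have 1: "((\<lambda>x. (m (\<tau> x) - m (\<tau> x0)) / (x - x0)) \<longlongrightarrow> l) (at x0)"
    by (simp add: has_field_derivative_iff)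
  have 2: "((\<lambda>x. M (\<tau> x)) \<longlongrightarrow> 1) (at x0)"
    using isCont_o2[OF ct M(2)] M(3) by (simp add: isCont_def)
  have "((\<lambda>x. (m (\<tau> x) - m (\<tau> x0)) / (x - x0) / M (\<tau> x)) \<longlongrightarrow> l / 1) (at x0)"
    by (intro tendsto_divide 1 2) simp
  moreover have "\<forall>\<^sub>F x in at x0. M (\<tau> x) \<noteq> 0"
    using tendsto_imp_eventually_ne[OF 2, of 0] by simp
  then have "\<forall>\<^sub>F x in at x0. (m (\<tau> x) - m (\<tau> x0)) / (x - x0) / M (\<tau> x) = (\<tau> x - \<tau> x0) / (x - x0)"
    by eventually_elim (simp add: M(1))
  ultimately have "((\<lambda>x. (\<tau> x - \<tau> x0) / (x - x0)) \<longlongrightarrow> l / 1) (at x0)"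
    by (rule Lim_transform_eventually)
  then show ?thesis by (intro that[of l]) (simp add: has_field_derivative_iff)
qed

section \<open>Flows of the two phases about their equilibria\<close>

context
  fixes p :: "('n::finite) buck"
  assumes wf: "well_formed p" and poles: "no_harmonic_poles p"
begin

abbreviation (input) "\<Phi> \<equiv> linear_flow (lin_field p)"

lemmas Phi_linear = linear_linear_flow[OF linear_lin_field, of p]
lemmas Phi_add = linear_flow_add[OF linear_lin_field, of p]

text \<open>A zero of the field is a constant orbit, hence a periodic one.\<close>

lemma lin_field_eq_0_imp:
  assumes "lin_field p x = 0" shows "x = 0"
proof (rule periodic_imp_0[OF wf poles])
  show "\<Phi> (period p) x = x"
    using linear_flow_unique[OF linear_lin_field, of "\<lambda>t. x" p "period p"] assms by simp
qed

lemma surj_lin_field: "surj (lin_field p)"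
proof (rule linear_inj_imp_surj[OF linear_lin_field])
  show "inj (lin_field p)"
    unfolding linear_injective_0[OF linear_lin_field] using lin_field_eq_0_imp by blast
qed

lemma surj_minus_flow: "\<exists>j. j - \<Phi> (period p) j = x"
proof -
  have lin: "linear (\<lambda>x. x - \<Phi> (period p) x)"
    by (intro linear_compose_sub linear_ident Phi_linear)
  have "inj (\<lambda>x. x - \<Phi> (period p) x)"
    unfolding linear_injective_0[OF lin] using periodic_imp_0[OF wf poles] by simp
  from surjD[OF linear_inj_imp_surj[OF lin this], of x] show ?thesis
    by (auto intro: sym)
qed

lemma minus_flow_unique:
  assumes "x - \<Phi> (period p) x = y - \<Phi> (period p) y" shows "x = y"
proof -
  have "\<Phi> (period p) (x - y) = x - y"
    using assms by (simp add: linear_diff[OF Phi_linear] algebra_simps)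
  from periodic_imp_0[OF wf poles this] show ?thesis by simp
qed

text \<open>A zero exists because \<open>lin_field\<close> is onto. Centred at it, the affine flow
  becomes a linear one.\<close>

definition equilibrium :: "real \<Rightarrow> 'n state" where
  "equilibrium vd = (SOME q. field p vd q = 0)"

lemma field_equilibrium: "field p vd (equilibrium vd) = 0"
proof -
  obtain q where "lin_field p q = - (vd / inductance p, 0, - (v_ref p *\<^sub>R comp_B p))"
    using surj_lin_field by (metis surjD)
  then have "field p vd q = 0" by (simp add: field_eq zero_prod_def)
  then show ?thesis unfolding equilibrium_def by (rule someI)
qed

lemma field_eq_equilibrium: "field p vd x = lin_field p (x - equilibrium vd)"
  using field_equilibrium[of vd] unfolding field_eq linear_diff[OF linear_lin_field]
  by (simp add: eq_neg_iff_add_eq_0[symmetric])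

lemma flow_eq: "flow p vd x = (\<lambda>t. equilibrium vd + \<Phi> t (x - equilibrium vd))"
  unfolding flow_def
proof (rule the_equality)
  show "trajectory p vd x (\<lambda>t. equilibrium vd + \<Phi> t (x - equilibrium vd))"
    unfolding trajectory_def field_eq_equilibrium
    by (auto simp: linear_flow_0[OF linear_lin_field]
      intro!: derivative_eq_intros linear_lin_field)
next
  fix X assume X: "trajectory p vd x X"
  have *: "((\<lambda>t. X t - equilibrium vd) has_vector_derivative lin_field p (X t - equilibrium vd)) (at t)" for t
    using X unfolding trajectory_def field_eq_equilibrium
    by (auto intro!: derivative_eq_intros)
  have "X 0 = x" using X by (simp add: trajectory_def)
  then have "X t - equilibrium vd = \<Phi> t (x - equilibrium vd)" for t
    using linear_flow_unique[OF linear_lin_field *] by simp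
  then show "X = (\<lambda>t. equilibrium vd + \<Phi> t (x - equilibrium vd))"
    by (simp add: fun_eq_iff diff_eq_eq add.commute)
qed

section \<open>The switching instant as first zero of the ramp gap\<close>

lemma bdd_below_switching: "bdd_below (insert (period p) {t. 0 \<le> t \<and> t < period p \<and> Q t})"
  using wf by (intro bdd_belowI[of _ 0]) (auto simp: well_formed_def)

lemma switching_instant_bounds: "0 \<le> switching_instant p x" "switching_instant p x \<le> period p"
  using wf unfolding switching_instant_def
  by (auto intro!: cInf_greatest cInf_lower bdd_below_switching simp: well_formed_def)

text \<open>The ramp is continued as a straight line instead of through \<open>frac\<close>, so that
  the gap is differentiable everywhere; within the cycle both agree.\<close>

definition ramp_gap :: "'n state \<Rightarrow> real \<Rightarrow> real" where
  "ramp_gap x t = comp_out p (flow p (v_source p) x t) - ramp_amp p * t / period p"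

lemma continuous_on_ramp_gap: "continuous_on A (ramp_gap x)"
proof -
  have "continuous_on A (\<lambda>t. lin_out p (flow p (v_source p) x t))" for A
    unfolding flow_eq linear_add[OF linear_lin_out]
    using linear_flow_has_real_derivative[OF linear_lin_field linear_lin_out]
    by (intro continuous_intros continuous_at_imp_continuous_on ballI DERIV_isCont)
  then show ?thesis
    using wf unfolding ramp_gap_def[abs_def] comp_out_eq
    by (intro continuous_intros) (auto simp: well_formed_def)
qed

lemma ramp_le_iff:
  assumes "0 \<le> t" "t < period p"
  shows "comp_out p (flow p (v_source p) x t) \<le> ramp p t \<longleftrightarrow> ramp_gap x t \<le> 0"
proof -
  have "frac (t / period p) = t / period p"
    using assms by (simp add: frac_eq)
  then show ?thesis by (simp add: ramp_def ramp_gap_def)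
qed

lemma ramp_gap_before_switching:
  assumes "0 \<le> t" "t < switching_instant p x"
  shows "ramp_gap x t > 0"
proof (rule ccontr)
  assume "\<not> ramp_gap x t > 0"
  then have "switching_instant p x \<le> t"
    unfolding switching_instant_def using assms switching_instant_bounds(2)[of x]
    by (intro cInf_lower bdd_below_switching) (auto simp: ramp_le_iff)
  then show False using assms by simp
qed

text \<open>Strictly inside the cycle the infimum is a genuine crossing. A positive gap there would
  persist nearby and push the infimum to the right; positivity before it excludes a negative gap by
  continuity.\<close>

lemma ramp_gap_at_switching:
  assumes "0 < switching_instant p x" "switching_instant p x < period p"
  shows "ramp_gap x (switching_instant p x) = 0"
proof (rule antisym)
  let ?s = "switching_instant p x"
  have cont: "(ramp_gap x \<longlongrightarrow> ramp_gap x ?s) (at ?s)"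
    using continuous_on_ramp_gap[of UNIV x] by (simp add: continuous_on_def)
  show "ramp_gap x ?s \<le> 0"
  proof (rule ccontr)
    assume "\<not> ramp_gap x ?s \<le> 0"
    then have "\<forall>\<^sub>F t in at ?s. ramp_gap x t > 0"
      using order_tendstoD(1)[OF cont] by simp
    then obtain e where e: "e > 0" "\<And>t. t \<noteq> ?s \<Longrightarrow> dist t ?s < e \<Longrightarrow> ramp_gap x t > 0"
      by (auto simp: eventually_at)
    have "min (period p) (?s + e) \<le>
        Inf (insert (period p) {t. 0 \<le> t \<and> t < period p \<and> comp_out p (flow p (v_source p) x t) \<le> ramp p t})"
    proof (rule cInf_greatest)
      fix t assume "t \<in> insert (period p) {t. 0 \<le> t \<and> t < period p \<and> comp_out p (flow p (v_source p) x t) \<le> ramp p t}"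
      then consider "t = period p" | "0 \<le> t" "t < period p" "ramp_gap x t \<le> 0"
        by (auto simp: ramp_le_iff)
      then show "min (period p) (?s + e) \<le> t"
      proof cases
        case 2
        then have "\<not> t < ?s" using ramp_gap_before_switching[of t x] by linarith
        moreover have "t \<noteq> ?s" using 2 \<open>\<not> ramp_gap x ?s \<le> 0\<close> by auto
        ultimately have "\<not> dist t ?s < e" using e(2)[of t] 2 by auto
        with \<open>\<not> t < ?s\<close> show ?thesis by (simp add: dist_real_def)
      qed simp
    qed simp
    then have "min (period p) (?s + e) \<le> ?s" by (simp only: switching_instant_def[of p x, symmetric])
    then show False using e assms by simp
  qed
  have "\<forall>\<^sub>F t in at_left ?s. 0 \<le> ramp_gap x t"
    using assms ramp_gap_before_switching[of _ x]
    by (auto simp: eventually_at_left intro!: exI[of _ 0] less_imp_le)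
  moreover have "(ramp_gap x \<longlongrightarrow> ramp_gap x ?s) (at_left ?s)"
    using cont by (simp add: filterlim_at_split)
  ultimately show "0 \<le> ramp_gap x ?s"
    by (intro tendsto_lowerbound) auto
qed


text \<open>Both phases share the linear flow, so the initial state is transported over the full
  period and the switching instant survives only in the last term.\<close>

lemma sampled_map_eq:
  "sampled_map p x = equilibrium 0 + \<Phi> (period p) (x - equilibrium (v_source p))
     - \<Phi> (period p - switching_instant p x) (equilibrium 0 - equilibrium (v_source p))"
proof -
  let ?s = "switching_instant p x" and ?q0 = "equilibrium 0" and ?q1 = "equilibrium (v_source p)"
  have "sampled_map p x = ?q0 + \<Phi> (period p - ?s) (\<Phi> ?s (x - ?q1) - (?q0 - ?q1))"
    by (simp add: sampled_map_def flow_eq Let_def algebra_simps)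
  also have "\<dots> = ?q0 + (\<Phi> ((period p - ?s) + ?s) (x - ?q1) - \<Phi> (period p - ?s) (?q0 - ?q1))"
    by (simp only: linear_diff[OF Phi_linear] Phi_add)
  finally show ?thesis by simp
qed

lemma lin_field_equilibrium_diff:
  "lin_field p (equilibrium 0 - equilibrium (v_source p)) = (v_source p / inductance p, 0, 0)"
  using field_equilibrium[of 0] field_equilibrium[of "v_source p"]
  unfolding linear_diff[OF linear_lin_field]
  by (simp add: field_eq add_eq_0_iff zero_prod_def[symmetric] prod_eq_iff)

text \<open>The flow is invertible, so x returns to itself after time r, and so does
  \<open>lin_field p x\<close>, which commutes with the flow. A closed orbit carries no inductor
  current.\<close>

lemma flow_shift_eq_imp_0:
  assumes r: "r > 0" and x: "\<Phi> (t + r) x = \<Phi> t x"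
  shows "fst (lin_field p x) = 0"
proof -
  have "\<Phi> t (\<Phi> r x - x) = 0"
    using x by (simp add: Phi_add linear_diff[OF Phi_linear])
  then have "\<Phi> r x = x" by (simp add: linear_flow_eq_0_iff[OF linear_lin_field])
  then have "\<Phi> r (lin_field p x) = lin_field p x"
    by (simp add: linear_flow_commute[OF linear_lin_field])
  from periodic_imp_power_stage_0(1)[OF wf r this] show ?thesis .
qed

text \<open>At x = x0 and t = d this is the \<sigma> of the introduction.\<close>

definition ramp_gap_slope :: "'n state \<Rightarrow> real \<Rightarrow> real" where
  "ramp_gap_slope x t = - lin_out p (lin_field p (\<Phi> t (x - equilibrium (v_source p)))) - ramp_amp p / period p"

lemma ramp_gap_add:
  "ramp_gap (x + h) t = ramp_gap x t - lin_out p (\<Phi> t h)"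
proof -
  have "flow p (v_source p) (x + h) t = flow p (v_source p) x t + \<Phi> t h"
    unfolding flow_eq by (simp add: linear_add[OF Phi_linear, symmetric] algebra_simps)
  then show ?thesis by (simp add: ramp_gap_def comp_out_eq linear_add[OF linear_lin_out])
qed

lemma ramp_gap_has_real_derivative: "(ramp_gap x has_real_derivative ramp_gap_slope x t) (at t)"
  unfolding ramp_gap_def[abs_def] comp_out_eq flow_eq linear_add[OF linear_lin_out]
  using wf
  by (auto intro!: derivative_eq_intros linear_flow_has_real_derivative[OF linear_lin_field linear_lin_out]
      simp: ramp_gap_slope_def well_formed_def)

section \<open>Derivative of the sampled map at a steady state\<close>

context
  fixes x0 :: "'n state" and d :: real
  assumes ss: "steady_state p x0 d"
begin

lemma switching_x0: "switching_instant p x0 = d" "0 < d" "d < period p"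
  using ss by (auto simp: steady_state_def)

text \<open>
  The switching instant enters the sampled map only through an injective curve with nonvanishing
  velocity (the power stage has no periodic solutions), so differentiability of the sampled map
  forces differentiability of the switching instant, even without a transversality assumption.
\<close>

lemma sampled_map_derivative:
  assumes dP: "(sampled_map p has_derivative P') (at x0)"
  obtains l where "P' h = \<Phi> (period p) h + l *\<^sub>R \<Phi> (period p - d) (v_source p / inductance p, 0, 0)"
    and "ramp_gap_slope x0 d * l = lin_out p (\<Phi> d h)"
proof -
  define T where "T = period p"
  define e where "e = equilibrium 0 - equilibrium (v_source p)"
  define b :: "'n state" where "b = (v_source p / inductance p, 0, 0)"
  \<comment> \<open>Along the line x0 + r h, the sampled map is this curve at the switching instant
    plus terms affine in r.\<close>
  define F where "F t = - \<Phi> (T - t) e" for t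
  define \<tau> where "\<tau> r = switching_instant p (x0 + r *\<^sub>R h)" for r
  have fe: "lin_field p e = b" by (simp add: e_def b_def lin_field_equilibrium_diff)
  have b0: "fst b \<noteq> 0" using wf by (simp add: b_def well_formed_def)
  have tau0: "\<tau> 0 = d" by (simp add: \<tau>_def switching_x0)
  have dF: "(F has_vector_derivative \<Phi> (T - t) b) (at t)" for t
  proof -
    have "((\<lambda>t. T - t) has_vector_derivative - 1) (at t)"
      by (auto intro!: derivative_eq_intros)
    from vector_diff_chain_at[OF this linear_flow_has_vector_derivative[OF linear_lin_field, of p e]]
    have "((\<lambda>t. \<Phi> (T - t) e) has_vector_derivative - \<Phi> (T - t) b) (at t)"
      by (simp add: o_def fe linear_flow_commute[OF linear_lin_field, symmetric])
    from has_vector_derivative_minus[OF this] show ?thesis by (simp add: F_def[abs_def])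
  qed
  have cF: "continuous_on {0..T} F"
    by (intro continuous_at_imp_continuous_on ballI has_vector_derivative_continuous[OF dF])
  \<comment> \<open>Two equal values would force the current component of
    \<open>lin_field p e\<close>, which is that of \<open>b\<close>, to vanish.\<close>
  have injF: "inj_on F {0..T}"
  proof (rule linorder_inj_onI')
    fix i j :: real assume "i < j"
    show "F i \<noteq> F j"
    proof
      assume "F i = F j"
      then have "\<Phi> ((T - j) + (j - i)) e = \<Phi> (T - j) e" by (simp add: F_def)
      from flow_shift_eq_imp_0[OF _ this] \<open>i < j\<close> b0 show False by (simp add: fe)
    qed
  qed
  have Ftau: "F (\<tau> r) = sampled_map p (x0 + r *\<^sub>R h) - (equilibrium 0 + \<Phi> T (x0 - equilibrium (v_source p))) - r *\<^sub>R \<Phi> T h" for r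
  proof -
    have "x0 + r *\<^sub>R h - equilibrium (v_source p) = (x0 - equilibrium (v_source p)) + r *\<^sub>R h" by simp
    then have "\<Phi> T (x0 + r *\<^sub>R h - equilibrium (v_source p)) = \<Phi> T (x0 - equilibrium (v_source p)) + r *\<^sub>R \<Phi> T h"
      by (simp only: linear_add[OF Phi_linear] linear_scale[OF Phi_linear])
    then show ?thesis unfolding sampled_map_eq by (simp add: F_def \<tau>_def T_def e_def)
  qed
  have dS: "((\<lambda>r. sampled_map p (x0 + r *\<^sub>R h)) has_vector_derivative P' h) (at 0)"
  proof -
    have "((\<lambda>r. x0 + r *\<^sub>R h) has_derivative (\<lambda>r. r *\<^sub>R h)) (at 0)"
      by (auto intro!: derivative_eq_intros)
    from diff_chain_at[OF this, of "sampled_map p" P'] dP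
    show ?thesis
      by (simp add: has_vector_derivative_def o_def linear_scale[OF has_derivative_linear[OF dP]])
  qed
  have comp: "((\<lambda>r. F (\<tau> r)) has_vector_derivative P' h - \<Phi> T h) (at 0)"
    unfolding Ftau by (auto intro!: derivative_eq_intros dS)
  have bnd: "\<tau> r \<in> {0..T}" for r
    using switching_instant_bounds by (simp add: \<tau>_def T_def)
  have "\<Phi> (T - \<tau> 0) b \<noteq> 0"
    using b0 by (auto simp: linear_flow_eq_0_iff[OF linear_lin_field])
  from has_real_derivative_through_injective_curve[OF cF injF bnd dF this comp]
  obtain l where l: "(\<tau> has_real_derivative l) (at 0)" .
  have "((\<lambda>r. F (\<tau> r)) has_vector_derivative l *\<^sub>R \<Phi> (T - \<tau> 0) b) (at 0)"
    using vector_diff_chain_at[OF l[unfolded has_real_derivative_iff_has_vector_derivative] dF]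
    by (simp add: o_def)
  from vector_derivative_unique_at[OF comp this]
  have 1: "P' h = \<Phi> T h + l *\<^sub>R \<Phi> (T - d) b" by (simp add: tau0 algebra_simps)
  define k where "k t = lin_out p (\<Phi> t h)" for t
  have dk: "(k has_real_derivative lin_out p (lin_field p (\<Phi> t h))) (at t)" for t
    unfolding k_def[abs_def] by (rule linear_flow_has_real_derivative[OF linear_lin_field linear_lin_out])
  \<comment> \<open>Implicit differentiation: the crossing condition of the perturbed state holds
    for all small r, so this derivative must be zero, which is the equation for
    \<open>l\<close>.\<close>
  have "((\<lambda>r. ramp_gap x0 (\<tau> r) - r * k (\<tau> r)) has_real_derivative ramp_gap_slope x0 d * l - k d) (at 0)"
    using DERIV_chain2[OF ramp_gap_has_real_derivative l, of x0] DERIV_chain2[OF dk l]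
    by (auto intro!: derivative_eq_intros simp: tau0)
  moreover have "\<forall>\<^sub>F r in nhds 0. ramp_gap x0 (\<tau> r) - r * k (\<tau> r) = 0"
  proof -
    \<comment> \<open>By continuity the switching instant stays strictly inside the cycle for small
      r, where it is a true crossing.\<close>
    have "(\<tau> \<longlongrightarrow> \<tau> 0) (nhds 0)"
      using DERIV_isCont[OF l] unfolding isCont_def tendsto_at_iff_tendsto_nhds .
    then have tend: "(\<tau> \<longlongrightarrow> d) (nhds 0)" by (simp only: tau0)
    have "\<forall>\<^sub>F r in nhds 0. 0 < \<tau> r" "\<forall>\<^sub>F r in nhds 0. \<tau> r < period p"
      by (rule order_tendstoD[OF tend], rule switching_x0)+
    then show ?thesis
    proof eventually_elim
      case (elim r)
      then have "ramp_gap (x0 + r *\<^sub>R h) (\<tau> r) = 0"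
        unfolding \<tau>_def by (rule ramp_gap_at_switching)
      then show ?case
        by (simp add: ramp_gap_add k_def linear_scale[OF Phi_linear] linear_scale[OF linear_lin_out])
    qed
  qed
  then have "((\<lambda>r. ramp_gap x0 (\<tau> r) - r * k (\<tau> r)) has_real_derivative 0) (at 0)"
    by (subst DERIV_cong_ev[OF refl _ refl, where g = "\<lambda>_. 0"]) auto
  ultimately have "ramp_gap_slope x0 d * l - k d = 0" by (rule DERIV_unique)
  then have 2: "ramp_gap_slope x0 d * l = lin_out p (\<Phi> d h)" by (simp add: k_def)
  show ?thesis using that 1 2 unfolding T_def b_def by blast
qed

text \<open>
  A tangential crossing would force \<open>lin_out\<close> to vanish, and then \<open>y\<close> and the ramp are both
  constant and cannot meet for the first time inside the cycle.
\<close>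

lemma ramp_gap_slope_nonzero:
  assumes dP: "(sampled_map p has_derivative P') (at x0)"
  shows "ramp_gap_slope x0 d \<noteq> 0"
proof
  assume 0: "ramp_gap_slope x0 d = 0"
  \<comment> \<open>The direction \<open>\<Phi>\<^sub>-\<^sub>d w\<close> makes the right-hand side
    of the crossing equation equal to \<open>lin_out p w\<close> for an arbitrary w.\<close>
  have out0: "lin_out p w = 0" for w
  proof -
    obtain l where "ramp_gap_slope x0 d * l = lin_out p (\<Phi> d (\<Phi> (- d) w))"
      using sampled_map_derivative[OF dP] by metis
    then show ?thesis using 0 by (simp add: linear_flow_uminus[OF linear_lin_field])
  qed
  have "ramp_gap x0 0 > 0" using ramp_gap_before_switching[of 0 x0] switching_x0 by simp
  moreover have "ramp_gap x0 d = 0" using ramp_gap_at_switching[of x0] switching_x0 by simp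
  moreover have "ramp_amp p = 0" using 0 wf by (simp add: ramp_gap_slope_def out0 well_formed_def)
  then have "ramp_gap x0 0 = ramp_gap x0 d" by (simp add: ramp_gap_def comp_out_eq out0)
  ultimately show False by simp
qed

end

end

section \<open>The harmonic condition for the eigenvalue one\<close>

theorem theorem2:
  fixes p :: "('n::finite) buck" and x0 :: "'n state" and d D :: real
  assumes "well_formed p"
    and "no_harmonic_poles p"
    and "steady_state p x0 d"
    and "D = d / period p"
    and "sampled_map p differentiable (at x0)"
  shows "\<exists>S. bilateral_sums
               (\<lambda>n. exp (\<i> * of_real (2 * of_int n * pi * D)) *
                     HB_gain p (\<i> * of_int n * of_real (switching_freq p))) S \<and>
             (saddle_node p x0 \<longleftrightarrow>
                of_real (v_source p) * S + of_real (ramp_amp p) = 0)"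
proof -
  note wf = assms(1) and poles = assms(2) and ss = assms(3)
  let ?f = "lin_field p" and ?\<Phi> = "linear_flow (lin_field p)"
  let ?q0 = "equilibrium p 0" and ?q1 = "equilibrium p (v_source p)"
  define T where "T = period p"
  define v where "v = v_source p"
  have T: "T > 0" and v: "v > 0" using wf by (auto simp: well_formed_def T_def v_def)
  note lin_Phi = linear_linear_flow[OF linear_lin_field, of p]
  note Phi_add = linear_flow_add[OF linear_lin_field, of p]
  note commute = linear_flow_commute[OF linear_lin_field, of p]
  note d = switching_x0[OF wf poles ss]
  define b :: "'n state" where "b = (1 / inductance p, 0, 0)"
  have vb: "(v / inductance p, 0, 0) = v *\<^sub>R b" by (simp add: b_def)
  have b0: "b \<noteq> 0" using wf by (simp add: b_def well_formed_def zero_prod_def)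
  \<comment> \<open>The vector called w in the introduction: the initial state of the periodic
    response to unit impulses in v_d.\<close>
  obtain j where j: "j - ?\<Phi> T j = b" using surj_minus_flow[OF wf poles] unfolding T_def by blast
  have unique: "x = y" if "x - ?\<Phi> T x = y - ?\<Phi> T y" for x y
    using minus_flow_unique[OF wf poles] that unfolding T_def by blast
  have flow_j: "?\<Phi> t j - ?\<Phi> T (?\<Phi> t j) = ?\<Phi> t b" for t
  proof -
    have "?\<Phi> T (?\<Phi> t j) = ?\<Phi> t (?\<Phi> T j)" unfolding Phi_add[symmetric] by (simp add: add.commute)
    then show ?thesis unfolding j[symmetric] by (simp add: linear_diff[OF lin_Phi])
  qed
  define K where "K t = lin_out p (?\<Phi> t j)" for t
  have jump: "j - ?\<Phi> (period p) j = (1 / inductance p, 0, 0)" using j by (simp add: b_def T_def)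
  have "bilateral_sums (\<lambda>n. cis (of_int n * (2 * pi / T) * d) *
      fourier_integral T (of_int n * (2 * pi / T)) K) (of_real (T * K d))"
    unfolding K_def
    using fourier_integral_series[OF d(2) _ linear_flow_has_real_derivative[OF linear_lin_field linear_lin_out]] d(3)
    by (simp add: T_def)
  moreover have "cis (of_int n * (2 * pi / T) * d) = exp (\<i> * of_real (2 * of_int n * pi * D))" for n
    by (simp add: cis_conv_exp assms(4) T_def mult_ac)
  moreover have "fourier_integral T (of_int n * (2 * pi / T)) K = HB_gain p (\<i> * of_int n * of_real (switching_freq p))" for n
    using lin_out_fourier[OF wf poles jump, of n] by (simp add: K_def[abs_def] T_def)
  ultimately have series: "bilateral_sums (\<lambda>n. exp (\<i> * of_real (2 * of_int n * pi * D)) *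
      HB_gain p (\<i> * of_int n * of_real (switching_freq p))) (of_real (T * K d))"
    by simp

  define P' where "P' = frechet_derivative (sampled_map p) (at x0)"
  have dP: "(sampled_map p has_derivative P') (at x0)"
    using assms(5) unfolding P'_def by (simp add: frechet_derivative_works)
  define s where "s = ramp_gap_slope p x0 d"
  have s0: "s \<noteq> 0" unfolding s_def by (rule ramp_gap_slope_nonzero[OF wf poles ss dP])
  have P': "\<exists>l. P' h = ?\<Phi> T h + (l * v) *\<^sub>R ?\<Phi> (T - d) b \<and> s * l = lin_out p (?\<Phi> d h)" for h
  proof -
    obtain l where l: "P' h = ?\<Phi> (period p) h + l *\<^sub>R ?\<Phi> (period p - d) (v_source p / inductance p, 0, 0)"
      "ramp_gap_slope p x0 d * l = lin_out p (?\<Phi> d h)"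
      by (rule sampled_map_derivative[OF wf poles ss dP])
    then show ?thesis
      by (intro exI[of _ l]) (simp only: T_def[symmetric] s_def[symmetric] v_def[symmetric] vb linear_scale[OF lin_Phi] scaleR_scaleR simp_thms)
  qed
  have shift: "?\<Phi> d (?\<Phi> (T - d) x) = ?\<Phi> T x" for x
    unfolding Phi_add[symmetric] by simp

  have slope: "s = v * K T - v * K d - ramp_amp p / T"
  proof -
    define u where "u = x0 - ?q1"
    define e where "e = ?q0 - ?q1"
    have fe: "?f e = v *\<^sub>R b"
      using lin_field_equilibrium_diff[OF wf poles] vb by (simp add: e_def v_def)
    have "sampled_map p x0 = x0" using ss by (simp add: steady_state_def)
    then have "u - ?\<Phi> T u = e - ?\<Phi> (T - d) e"
      unfolding sampled_map_eq[OF wf poles] d(1) u_def e_def T_def by (simp add: algebra_simps)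
    \<comment> \<open>Applying the field replaces the unknown difference of equilibria by a multiple
      of \<open>b\<close>, and injectivity of \<open>id - \<Phi>\<^sub>T\<close> then determines
      \<open>?f u\<close> in terms of \<open>j\<close>.\<close>
    then have "?f (u - ?\<Phi> T u) = ?f (e - ?\<Phi> (T - d) e)" by simp
    then have "?f u - ?\<Phi> T (?f u) = v *\<^sub>R b - ?\<Phi> (T - d) (v *\<^sub>R b)"
      unfolding linear_diff[OF linear_lin_field] commute[symmetric] fe .
    also have "\<dots> = v *\<^sub>R (j - ?\<Phi> T j) - v *\<^sub>R (?\<Phi> (T - d) j - ?\<Phi> T (?\<Phi> (T - d) j))"
      unfolding flow_j j linear_scale[OF lin_Phi] ..
    also have "\<dots> = v *\<^sub>R (j - ?\<Phi> (T - d) j) - ?\<Phi> T (v *\<^sub>R (j - ?\<Phi> (T - d) j))"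
      by (simp add: linear_scale[OF lin_Phi] linear_diff[OF lin_Phi] algebra_simps)
    finally have "?f u = v *\<^sub>R (j - ?\<Phi> (T - d) j)" by (rule unique)
    then have "?\<Phi> d (?f u) = v *\<^sub>R (?\<Phi> d j - ?\<Phi> T j)"
      by (simp add: linear_scale[OF lin_Phi] linear_diff[OF lin_Phi] shift)
    then have "lin_out p (?f (?\<Phi> d u)) = v * (K d - K T)"
      by (simp add: commute[symmetric] linear_scale[OF linear_lin_out] linear_diff[OF linear_lin_out] K_def)
    then show ?thesis unfolding s_def ramp_gap_slope_def[OF wf poles] u_def[symmetric]
      by (simp add: T_def algebra_simps)
  qed

  have "is_eigenvalue P' 1 \<longleftrightarrow> s = v * K T"
  proof
    assume "is_eigenvalue P' 1"
    then obtain h where h: "h \<noteq> 0" "P' h = h" by (auto simp: is_eigenvalue_def)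
    obtain l where l: "P' h = ?\<Phi> T h + (l * v) *\<^sub>R ?\<Phi> (T - d) b" "s * l = lin_out p (?\<Phi> d h)"
      using P' by blast
    \<comment> \<open>The eigenvector equation is again an equation for
      \<open>id - \<Phi>\<^sub>T\<close>, so h must be a multiple of
      \<open>\<Phi>\<^sub>T\<^sub>-\<^sub>d j\<close>, with nonzero factor.\<close>
    have "h - ?\<Phi> T h = (l * v) *\<^sub>R (?\<Phi> (T - d) j - ?\<Phi> T (?\<Phi> (T - d) j))"
      using h(2) l(1) unfolding flow_j by (simp add: algebra_simps)
    also have "\<dots> = (l * v) *\<^sub>R ?\<Phi> (T - d) j - ?\<Phi> T ((l * v) *\<^sub>R ?\<Phi> (T - d) j)"
      by (simp add: linear_scale[OF lin_Phi] scaleR_diff_right)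
    finally have h_eq: "h = (l * v) *\<^sub>R ?\<Phi> (T - d) j" by (rule unique)
    with h(1) have "l \<noteq> 0" by auto
    moreover have "s * l = (l * v) * K T"
      unfolding l(2) by (subst h_eq) (simp add: linear_scale[OF lin_Phi] linear_scale[OF linear_lin_out] shift K_def)
    ultimately show "s = v * K T" by simp
  next
    assume s: "s = v * K T"
    \<comment> \<open>The first direction shows that, up to scaling, this is the only candidate for
      an eigenvector.\<close>
    define h where "h = ?\<Phi> (T - d) j"
    have "j \<noteq> 0" using j b0 by (auto simp: linear_0[OF lin_Phi])
    then have "h \<noteq> 0" by (simp add: h_def linear_flow_eq_0_iff[OF linear_lin_field])
    obtain l where l: "P' h = ?\<Phi> T h + (l * v) *\<^sub>R ?\<Phi> (T - d) b" "s * l = lin_out p (?\<Phi> d h)"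
      using P' by blast
    have "s * l = K T" unfolding l(2) by (simp add: h_def shift K_def)
    then have "K T * (l * v) = K T * 1" using s by (simp add: mult_ac)
    \<comment> \<open>Transversality enters here: a nonzero slope makes K T nonzero, so that it can
      be cancelled.\<close>
    moreover have "K T \<noteq> 0" using s s0 by auto
    ultimately have "l * v = 1" using mult_left_cancel by blast
    then have "P' h = h" unfolding l(1) flow_j[symmetric] by (simp add: h_def)
    with \<open>h \<noteq> 0\<close> show "is_eigenvalue P' 1"
      unfolding is_eigenvalue_def by (intro exI[of _ h]) simp
  qed
  \<comment> \<open>Inserting the slope cancels the terms v K T; what remains is multiplied by
    -T.\<close>
  also have "\<dots> \<longleftrightarrow> v * (T * K d) + ramp_amp p = 0"
    unfolding slope using T by (auto simp: field_simps)
  also have "\<dots> \<longleftrightarrow> of_real v * of_real (T * K d) + complex_of_real (ramp_amp p) = 0"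
    by (simp only: of_real_mult[symmetric] of_real_add[symmetric] of_real_eq_0_iff)
  finally show ?thesis
    using series assms(5) unfolding saddle_node_def P'_def v_def by blast
qed

end
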